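(* Let $\mu$ be a nontrivial probability Borel measure on the unit circle $\mathbb{T}$, and let $\{c_n\}_{n\ge 1}$ and $\{d_{n+1}\}_{n\ge 1}$ be the associated coefficients (defined in the context). Let $\{q_{n+1}\}_{n\ge1}$ be a scaling sequence for the positive chain sequence $\{d_{n+1}\}_{n\ge1}$, and define $$u_{n+1}^{(\pm)}=u^{(\pm)}(c_n,c_{n+1},q_{n+1}),\qquad n\ge 1.$$ If $$0\le \vartheta_1:=2\operatorname{arccot}\Big(\sup_{n\ge1}u_{n+1}^{(+)}\Big)<\vartheta_2:=2\operatorname{arccot}\Big(\inf_{n\ge1}u_{n+1}^{(-)}\Big)\le 2\pi,$$ then $$\operatorname{supp}\big(\mu-\mu(\{1\})\delta_1\big)\subseteq \mathcal{A}[\vartheta_1,\vartheta_2],$$ where $\delta_1$ is the Dirac delta at $z=1$.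
   Context: $\mathbb{T}=\{z\in\mathbb{C}:|z|=1\}$; a measure on $\mathbb{T}$ is nontrivial if its support is infinite. For $0<\vartheta_2-\vartheta_1\le2\pi$, $\mathcal{A}[\vartheta_1,\vartheta_2]=\{e^{i\theta}:\vartheta_1\le\theta\le\vartheta_2\}$. Coefficients. Let $\Phi_n$ be the monic orthogonal polynomials with respect to $\mu$ and $\alpha_{n-1}=-\overline{\Phi_n(0)}$, $n\ge1$, the Verblunsky coefficients ($|\alpha_n|<1$). Put $\tau_0=1$, $\tau_n=\dfrac{\tau_{n-1}-\overline{\alpha}_{n-1}}{1-\tau_{n-1}\alpha_{n-1}}$ for $n\ge1$ (so $|\tau_n|=1$). Then, for $n\ge1$, $$c_n=\frac{-\operatorname{Im}(\tau_{n-1}\alpha_{n-1})}{1-\operatorname{Re}(\tau_{n-1}\alpha_{n-1})},\qquad g_n=\frac12\,\frac{|1-\tau_{n-1}\alpha_{n-1}|^2}{1-\operatorname{Re}(\tau_{n-1}\alpha_{n-1})},\qquad d_{n+1}=(1-g_n)g_{n+1}.$$ (Equivalently, these are the coefficients in the recurrence $R_{n+1}(z)=[(1+ic_{n+1})z+(1-ic_{n+1})]R_n(z)-4d_{n+1}zR_{n-1}(z)$, $R_{-1}=0$, $R_0=1$, satisfied by $R_n(z)=\Big(\prod_{j=1}^n\frac{1-\tau_{j-1}\alpha_{j-1}}{1-\operatorname{Re}(\tau_{j-1}\alpha_{j-1})}\Big)\frac{z\Phi_n(z)-\tau_n\Phi_n^*(z)}{z-1}$, with $\Phi_n^*(z)=z^n\overline{\Phi_n(1/\bar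 z)}$.) Positive chain sequence: a sequence $\{d_{n+1}\}_{n\ge1}$ for which there is $\{g_n\}_{n\ge1}$ with $0\le g_1<1$, $0<g_n<1$ for $n\ge2$, and $d_{n+1}=(1-g_n)g_{n+1}$ for $n\ge1$. A scaling sequence for a positive chain sequence $\{d_{n+1}\}_{n\ge1}$ is a positive sequence $\{q_{n+1}\}_{n\ge1}$ with $q_{n+1}\le1$ for all $n$ such that $\{d_{n+1}/q_{n+1}\}_{n\ge1}$ is also a positive chain sequence. For $a,b\in\mathbb{R}$ and $0<q<1$, $u^{(-)}(a,b,q)<u^{(+)}(a,b,q)$ are the (real) roots of $(1-q)u^2-(a+b)u+ab-q=0$. For $q=1$: $u^{(+)}(a,b,1)=+\infty$ if $a+b\ge0$, $u^{(-)}(a,b,1)=-\infty$ if $a+b\le0$, and otherwise the value is the root $(ab-1)/(a+b)$ of the (then linear) equation. $\operatorname{arccot}$ takes values in $(0,\pi)$ on $\mathbb{R}$, with $\operatorname{arccot}(+\infty)=0$, $\operatorname{arccot}(-\infty)=\pi$. *)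

theory Defs
  imports "HOL-Probability.Giry_Monad" "HOL-Computational_Algebra.Polynomial"
begin

section \<open>Measures on the unit circle\<close>

definition unit_circle :: "complex set" where
  "unit_circle = sphere 0 1"

text \<open>The space of \<open>M\<close> carries the subspace topology, so its relatively open sets are the sets
  \<open>U \<inter> space M\<close> with \<open>U\<close> open.\<close>

definition msupport :: "'a::topological_space measure \<Rightarrow> 'a set" where
  "msupport M = {z \<in> space M. \<forall>U. open U \<longrightarrow> z \<in> U \<longrightarrow> emeasure M (U \<inter> space M) \<noteq> 0}"

definition nontrivial_measure :: "'a::topological_space measure \<Rightarrow> bool" where
  "nontrivial_measure M \<longleftrightarrow> infinite (msupport M)"

definition circle_arc :: "real \<Rightarrow> real \<Rightarrow> complex set" where
  "circle_arc \<theta>1 \<theta>2 = {cis \<theta> | \<theta>. \<theta>1 \<le> \<theta> \<and> \<theta> \<le> \<theta>2}"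

section \<open>Monic orthogonal polynomials and the associated coefficients\<close>

definition is_monic_orthogonal :: "complex measure \<Rightarrow> nat \<Rightarrow> complex poly \<Rightarrow> bool" where
  "is_monic_orthogonal M n p \<longleftrightarrow>
     degree p = n \<and> lead_coeff p = 1 \<and>
     (\<forall>r. degree r < n \<longrightarrow> (LINT z|M. poly p z * cnj (poly r z)) = 0)"

definition monic_OP :: "complex measure \<Rightarrow> nat \<Rightarrow> complex poly" where
  "monic_OP M n = (THE p. is_monic_orthogonal M n p)"

definition verblunsky :: "complex measure \<Rightarrow> nat \<Rightarrow> complex" where
  "verblunsky M n = - cnj (poly (monic_OP M (Suc n)) 0)"

fun tau :: "complex measure \<Rightarrow> nat \<Rightarrow> complex" where
  "tau M 0 = 1"
| "tau M (Suc n) = (tau M n - cnj (verblunsky M n)) / (1 - tau M n * verblunsky M n)"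

text \<open>\<open>coeff_c M n\<close> and \<open>coeff_g M n\<close> are meaningful for \<open>n \<ge> 1\<close>, \<open>coeff_d M n\<close> for \<open>n \<ge> 2\<close>.\<close>

definition coeff_c :: "complex measure \<Rightarrow> nat \<Rightarrow> real" where
  "coeff_c M n =
     - Im (tau M (n - 1) * verblunsky M (n - 1)) /
     (1 - Re (tau M (n - 1) * verblunsky M (n - 1)))"

definition coeff_g :: "complex measure \<Rightarrow> nat \<Rightarrow> real" where
  "coeff_g M n =
     1 / 2 * ((cmod (1 - tau M (n - 1) * verblunsky M (n - 1)))\<^sup>2 /
              (1 - Re (tau M (n - 1) * verblunsky M (n - 1))))"

definition coeff_d :: "complex measure \<Rightarrow> nat \<Rightarrow> real" where
  "coeff_d M n = (1 - coeff_g M (n - 1)) * coeff_g M n"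

section \<open>Chain sequences and scaling sequences\<close>

text \<open>A function \<open>d\<close> represents the sequence \<open>d 2, d 3, \<dots>\<close>; its values at \<open>0\<close> and \<open>1\<close> are irrelevant.
  The same convention is used for scaling sequences \<open>q\<close>.\<close>

definition positive_chain_sequence :: "(nat \<Rightarrow> real) \<Rightarrow> bool" where
  "positive_chain_sequence d \<longleftrightarrow>
     (\<exists>g. 0 \<le> g 1 \<and> g 1 < 1 \<and> (\<forall>n\<ge>2. 0 < g n \<and> g n < 1) \<and>
          (\<forall>n\<ge>1. d (n + 1) = (1 - g n) * g (n + 1)))"

definition scaling_sequence :: "(nat \<Rightarrow> real) \<Rightarrow> (nat \<Rightarrow> real) \<Rightarrow> bool" where
  "scaling_sequence d q \<longleftrightarrow>
     (\<forall>n\<ge>1. 0 < q (n + 1) \<and> q (n + 1) \<le> 1) \<and>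
     positive_chain_sequence (\<lambda>n. d n / q n)"

section \<open>The roots of the quadratic equation and the inverse cotangent\<close>

text \<open>For \<open>0 < q < 1\<close> the discriminant equals
  \<open>(1 - q) * (a - b)\<^sup>2 + q * (a + b)\<^sup>2 + 4 * q * (1 - q) > 0\<close>, so
  \<open>u_roots a b q\<close> consists of exactly two reals.\<close>

definition u_roots :: "real \<Rightarrow> real \<Rightarrow> real \<Rightarrow> real set" where
  "u_roots a b q = {u. (1 - q) * u\<^sup>2 - (a + b) * u + a * b - q = 0}"

definition u_plus :: "real \<Rightarrow> real \<Rightarrow> real \<Rightarrow> ereal" where
  "u_plus a b q =
     (if q = 1 then (if a + b \<ge> 0 then \<infinity> else ereal ((a * b - 1) / (a + b)))
      else ereal (Max (u_roots a b q)))"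

definition u_minus :: "real \<Rightarrow> real \<Rightarrow> real \<Rightarrow> ereal" where
  "u_minus a b q =
     (if q = 1 then (if a + b \<le> 0 then -\<infinity> else ereal ((a * b - 1) / (a + b)))
      else ereal (Min (u_roots a b q)))"

definition arccot :: "ereal \<Rightarrow> real" where
  "arccot x =
     (if x = \<infinity> then 0 else if x = -\<infinity> then pi
      else (THE t. 0 < t \<and> t < pi \<and> cot t = real_of_ereal x))"

end

theory Submission
  imports Defs "HOL-Analysis.Weierstrass_Theorems"
begin

text \<open>The coordinate \<open>x = cot (\<theta> / 2)\<close> of \<open>z = exp (i \<theta>)\<close> maps the unit circle without \<open>1\<close> onto the real line, and
  \<open>weight s\<close> is the trigonometric polynomial \<open>2 * (s - x) / (1 + x\<^sup>2)\<close> of degree one.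
  Divide the para-orthogonal polynomial \<open>z \<Phi>\<^sub>n - \<tau>\<^sub>n \<Phi>\<^sub>n\<^sup>*\<close>, which vanishes at \<open>1\<close>, by \<open>z - 1\<close>, and
  shift the quotients alternately to the two sides so that they form a basis of the Laurent polynomials
  (as in the CMV construction). In this basis the form \<open>\<integral> weight s |p|\<^sup>2 d\<mu>\<close> is tridiagonal: up to
  positive scaling its diagonal entries are \<open>s - c\<^sub>n\<close>, and the squared moduli of its off-diagonal
  entries are \<open>d\<^sub>n\<^sub>+\<^sub>1 (s\<^sup>2 + 1)\<close>. For \<open>s\<close> beyond every root \<open>u\<^sup>(\<^sup>+\<^sup>)\<close> one has
  \<open>q\<^sub>n\<^sub>+\<^sub>1 (s\<^sup>2 + 1) \<le> (s - c\<^sub>n) (s - c\<^sub>n\<^sub>+\<^sub>1)\<close>, so the chain sequence \<open>d\<^sub>n\<^sub>+\<^sub>1 / q\<^sub>n\<^sub>+\<^sub>1\<close> makes the form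
  nonnegative. By density of the Laurent polynomials, \<open>weight s \<ge> 0\<close> almost everywhere, i.e. the arc
  \<open>x > s\<close> is a null set; the other end is symmetric.\<close>

section \<open>Orthogonal polynomials on the unit circle\<close>

text \<open>The reversed polynomial \<open>z^n * cnj (p (1 / cnj z))\<close>. The index
  \<open>n\<close> is kept apart from the degree because polynomials of degree below
  \<open>n\<close> are reversed as well.\<close>

definition poly_star :: "nat \<Rightarrow> complex poly \<Rightarrow> complex poly" where
  "poly_star n p = (\<Sum>k\<le>n. monom (cnj (coeff p (n - k))) k)"

lemma coeff_poly_star: "coeff (poly_star n p) k = (if k \<le> n then cnj (coeff p (n - k)) else 0)"
  by (simp add: poly_star_def coeff_sum)

lemma degree_poly_star_le: "degree (poly_star n p) \<le> n"
  by (rule degree_le) (simp add: coeff_poly_star)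

lemma poly_poly_star:
  assumes "degree p \<le> n" "cmod z = 1"
  shows "poly (poly_star n p) z = z ^ n * cnj (poly p z)"
proof -
  have zz: "z * cnj z = 1"
    using assms(2) by (simp add: complex_norm_square[symmetric])
  have zk: "z ^ (n - k) = z ^ n * cnj z ^ k" if "k \<le> n" for k
  proof -
    have "z ^ n * cnj z ^ k = z ^ (n - k) * (z ^ k * cnj z ^ k)"
      using that by (simp add: power_add[symmetric] mult.assoc[symmetric])
    also have "\<dots> = z ^ (n - k)"
      by (simp add: power_mult_distrib[symmetric] zz)
    finally show ?thesis ..
  qed
  have "poly (poly_star n p) z = (\<Sum>k\<le>n. cnj (coeff p (n - k)) * z ^ k)"
    by (simp add: poly_star_def poly_sum poly_monom)
  also have "\<dots> = (\<Sum>k\<le>n. cnj (coeff p k) * z ^ (n - k))"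
    by (rule sum.reindex_bij_witness[of _ "\<lambda>k. n - k" "\<lambda>k. n - k"]) auto
  also have "\<dots> = (\<Sum>k\<le>n. z ^ n * (cnj (coeff p k) * cnj z ^ k))"
    by (intro sum.cong refl) (simp add: zk)
  also have "\<dots> = z ^ n * (\<Sum>k\<le>n. cnj (coeff p k) * cnj z ^ k)"
    by (simp add: sum_distrib_left)
  also have "(\<Sum>k\<le>n. cnj (coeff p k) * cnj z ^ k) = cnj (poly p z)"
    by (subst poly_as_sum_of_monoms'[OF assms(1), symmetric]) (simp add: poly_sum poly_monom)
  finally show ?thesis .
qed

locale circle_measure = prob_space M for M :: "complex measure" +
  assumes sets_M: "sets M = sets (restrict_space borel unit_circle)"
    and nontrivial: "nontrivial_measure M"
begin

lemma space_M: "space M = sphere 0 1"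
  using sets_eq_imp_space_eq[OF sets_M] by (simp add: unit_circle_def)

lemma norm_space: "z \<in> space M \<Longrightarrow> cmod z = 1"
  by (simp add: space_M)

lemma sets_Int_space: "A \<in> sets borel \<Longrightarrow> A \<inter> space M \<in> sets M"
  by (auto simp: sets_M sets_restrict_space space_M unit_circle_def)

lemma integrable_cont:
  fixes f :: "complex \<Rightarrow> 'b::{banach, second_countable_topology}"
  assumes "continuous_on (sphere 0 1) f"
  shows "integrable M f"
proof -
  have "compact (f ` sphere 0 1)"
    using assms by (intro compact_continuous_image) auto
  then obtain B where B: "\<forall>y\<in>f ` sphere 0 1. norm y \<le> B"
    using compact_imp_bounded bounded_iff by blast
  have "f \<in> borel_measurable (restrict_space borel unit_circle)"
    using assms by (intro borel_measurable_continuous_on_restrict) (simp add: unit_circle_def)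
  then have "f \<in> borel_measurable M"
    by (simp cong: measurable_cong_sets add: sets_M)
  then show ?thesis
    using B by (intro integrable_const_bound[of _ B]) (auto simp: space_M)
qed

section \<open>The inner product of polynomials with respect to the measure\<close>

definition ip :: "complex poly \<Rightarrow> complex poly \<Rightarrow> complex" where
  "ip p r = (LINT z|M. poly p z * cnj (poly r z))"

lemma integrable_ip [simp]: "integrable M (\<lambda>z. poly p z * cnj (poly r z))"
  by (intro integrable_cont continuous_intros)

lemma ip_cong:
  assumes "\<And>z. cmod z = 1 \<Longrightarrow> poly p z * cnj (poly r z) = poly p' z * cnj (poly r' z)"
  shows "ip p r = ip p' r'"
  unfolding ip_def by (rule Bochner_Integration.integral_cong) (auto simp: norm_space assms)

lemma ip_zero_left [simp]: "ip 0 r = 0"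
  by (simp add: ip_def)

lemma ip_zero_right [simp]: "ip p 0 = 0"
  by (simp add: ip_def)

lemma ip_add_left: "ip (p + p') r = ip p r + ip p' r"
  by (simp add: ip_def ring_distribs)

lemma ip_diff_left: "ip (p - p') r = ip p r - ip p' r"
  by (simp add: ip_def ring_distribs)

lemma ip_smult_left: "ip (smult c p) r = c * ip p r"
  by (simp add: ip_def mult.assoc)

lemma ip_cnj: "cnj (ip p r) = ip r p"
  unfolding ip_def Bochner_Integration.integral_cnj[symmetric] by (simp add: mult.commute)

lemma ip_add_right: "ip p (r + r') = ip p r + ip p r'"
  by (metis ip_add_left ip_cnj complex_cnj_add)

lemma ip_diff_right: "ip p (r - r') = ip p r - ip p r'"
  by (metis ip_diff_left ip_cnj complex_cnj_diff)

lemma ip_smult_right: "ip p (smult c r) = cnj c * ip p r"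
  by (metis ip_smult_left ip_cnj complex_cnj_mult)

lemma ip_sum_left: "ip (\<Sum>k\<in>A. f k) r = (\<Sum>k\<in>A. ip (f k) r)"
  by (induction A rule: infinite_finite_induct) (simp_all add: ip_add_left)

lemma ip_sum_right: "ip p (\<Sum>k\<in>A. f k) = (\<Sum>k\<in>A. ip p (f k))"
  by (induction A rule: infinite_finite_induct) (simp_all add: ip_add_right)

lemma ip_shift: "ip (monom 1 k * p) (monom 1 k * r) = ip p r"
proof (rule ip_cong)
  fix z :: complex assume "cmod z = 1"
  then have "z ^ k * cnj z ^ k = 1"
    by (simp add: power_mult_distrib[symmetric] complex_norm_square[symmetric])
  then show "poly (monom 1 k * p) z * cnj (poly (monom 1 k * r) z) = poly p z * cnj (poly r z)"
    by (simp add: poly_monom mult.assoc mult.left_commute)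
qed

lemma ip_shift1: "ip (pCons 0 p) (pCons 0 r) = ip p r"
  using ip_shift[of 1 p r] by (simp add: monom_altdef)

text \<open>On the circle both integrands equal \<open>z^n\<close> times the conjugates of
  \<open>p\<close> and \<open>r\<close>, which is symmetric in the two.\<close>

lemma ip_poly_star:
  assumes "degree p \<le> n" "degree r \<le> n"
  shows "ip (poly_star n p) r = ip (poly_star n r) p"
  using assms by (intro ip_cong) (simp add: poly_poly_star)

lemma ip_poly_star_both:
  assumes "degree p \<le> n" "degree r \<le> n"
  shows "ip (poly_star n p) (poly_star n r) = ip r p"
proof (rule ip_cong)
  fix z :: complex assume z: "cmod z = 1"
  then have "z ^ n * cnj z ^ n = 1"
    by (simp add: power_mult_distrib[symmetric] complex_norm_square[symmetric])
  then show "poly (poly_star n p) z * cnj (poly (poly_star n r) z) = poly r z * cnj (poly p z)"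
    using assms z by (simp add: poly_poly_star mult.assoc mult.left_commute)
qed

lemma ip_self: "ip p p = of_real (LINT z|M. (cmod (poly p z))\<^sup>2)"
  unfolding ip_def by (simp add: complex_norm_square[symmetric] del: of_real_power)

text \<open>The zeros of \<open>p\<close> are finite in number but the support is infinite, so some
  support point lies in the open set where \<open>p\<close> is nonzero, and that set has positive
  measure.\<close>

lemma ip_self_pos:
  assumes "p \<noteq> 0"
  shows "Re (ip p p) > 0"
proof -
  have int: "integrable M (\<lambda>z. (cmod (poly p z))\<^sup>2)"
    by (intro integrable_cont continuous_intros)
  have "(LINT z|M. (cmod (poly p z))\<^sup>2) \<noteq> 0"
  proof
    assume "(LINT z|M. (cmod (poly p z))\<^sup>2) = 0"
    then have ae: "AE z in M. poly p z = 0"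
      using integral_nonneg_eq_0_iff_AE[OF int] by simp
    have "finite {z. poly p z = 0}"
      using assms poly_roots_finite by blast
    then obtain z where z: "z \<in> msupport M" "poly p z \<noteq> 0"
      using nontrivial unfolding nontrivial_measure_def
      by (metis (mono_tags, lifting) finite_subset mem_Collect_eq subsetI)
    have op: "open {z. poly p z \<noteq> 0}"
      by (intro open_Collect_neq continuous_intros)
    then have "{z. poly p z \<noteq> 0} \<inter> space M \<in> sets M"
      by (intro sets_Int_space borel_open)
    then have "emeasure M ({z. poly p z \<noteq> 0} \<inter> space M) = 0"
      using ae by (subst (asm) AE_iff_measurable[OF _ refl]) (auto simp: Int_def conj_commute)
    then show False
      using z op by (auto simp: msupport_def)
  qed
  moreover have "(LINT z|M. (cmod (poly p z))\<^sup>2) \<ge> 0"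
    by simp
  ultimately show ?thesis
    by (simp add: ip_self less_le)
qed

section \<open>Existence of the monic orthogonal polynomials and the Szego recurrence\<close>

abbreviation "\<Phi> \<equiv> monic_OP M"
abbreviation "\<alpha> \<equiv> verblunsky M"
abbreviation "\<tau> \<equiv> tau M"

lemma is_monic_orthogonal_ip:
  "is_monic_orthogonal M n p \<longleftrightarrow> degree p = n \<and> lead_coeff p = 1 \<and> (\<forall>r. degree r < n \<longrightarrow> ip p r = 0)"
  by (simp add: is_monic_orthogonal_def ip_def)

lemma monic_orthogonal_unique:
  assumes "is_monic_orthogonal M n p" "is_monic_orthogonal M n p'"
  shows "p = p'"
proof (rule ccontr)
  assume ne: "p \<noteq> p'"
  have "degree (p - p') \<le> n" "coeff (p - p') n = 0"
    using assms by (auto simp: is_monic_orthogonal_ip intro: degree_diff_le)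
  then have "degree (p - p') < n"
    using ne eq_zero_or_degree_less[of "p - p'" n] by auto
  then have "ip (p - p') (p - p') = 0"
    using assms by (simp add: is_monic_orthogonal_ip ip_diff_left)
  then show False
    using ip_self_pos[of "p - p'"] ne by simp
qed

text \<open>Reversal carries orthogonality to 1, ..., z^(n-1) over to z, ..., z^n: as
  \<open>r\<close> vanishes at 0, its reversal has degree below \<open>n\<close> (or is zero), and
  \<open>ip_poly_star\<close> moves the star from one argument to the other.\<close>

lemma star_orthogonal:
  assumes "is_monic_orthogonal M n p" "degree r \<le> n" "coeff r 0 = 0"
  shows "ip (poly_star n p) r = 0"
proof -
  have "ip (poly_star n r) p = 0"
  proof (cases n)
    case 0
    with assms have "r = 0"
      by (metis degree_0_id le_zero_eq of_nat_0 pCons_0_0 coeff_0 leading_coeff_0_iff)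
    then show ?thesis by (simp add: poly_star_def)
  next
    case (Suc m)
    have "degree (poly_star n r) \<le> m"
      by (rule degree_le) (auto simp: coeff_poly_star Suc assms(3) less_Suc_eq_le le_Suc_eq)
    then have "ip p (poly_star n r) = 0"
      using assms(1) Suc by (simp add: is_monic_orthogonal_ip)
    then show ?thesis by (metis ip_cnj complex_cnj_zero)
  qed
  then show ?thesis
    using assms by (subst ip_poly_star) (auto simp: is_monic_orthogonal_ip)
qed


text \<open>Since \<open>p\<close> is monic, \<open>poly_star n p\<close> has constant term 1, so it
  is orthogonal to its difference from 1; reversal preserves the norm.\<close>

lemma star_ip_1:
  assumes p: "is_monic_orthogonal M n p"
  shows "ip (poly_star n p) 1 = ip p p"
proof -
  have "degree p = n" "lead_coeff p = 1"
    using p by (auto simp: is_monic_orthogonal_ip)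
  moreover from this have "ip (poly_star n p) (poly_star n p - 1) = 0"
    by (intro star_orthogonal[OF p])
       (auto intro!: degree_diff_le degree_poly_star_le simp: coeff_poly_star)
  ultimately show ?thesis
    by (simp add: ip_diff_right ip_poly_star_both)
qed

text \<open>Replaces Gram-Schmidt: \<open>z * p\<close> and \<open>poly_star n p\<close> are both
  orthogonal to z, ..., z^n, and the scalar is chosen so that the combination is orthogonal to 1 as
  well.\<close>

lemma monic_orthogonal_Suc:
  assumes p: "is_monic_orthogonal M n p"
  shows "is_monic_orthogonal M (Suc n)
           (pCons 0 p - smult (ip (pCons 0 p) 1 / ip p p) (poly_star n p))"
    (is "is_monic_orthogonal M _ ?p'")
proof -
  let ?a = "ip (pCons 0 p) 1 / ip p p"
  have dp: "degree p = n" "lead_coeff p = 1" and orth: "\<And>r. degree r < n \<Longrightarrow> ip p r = 0"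
    using p by (auto simp: is_monic_orthogonal_ip)
  have p0: "p \<noteq> 0" using dp by auto
  have pp: "ip p p \<noteq> 0" using ip_self_pos[OF p0] by auto
  have c: "coeff ?p' (Suc n) = 1"
    using dp by (simp add: coeff_poly_star)
  have d: "degree ?p' \<le> Suc n"
    using dp degree_poly_star_le[of n p]
    by (intro degree_diff_le order.trans[OF degree_smult_le]) (auto simp: p0)
  have deg: "degree ?p' = Suc n"
    using c d by (metis le_antisym le_degree zero_neq_one)
  have "ip ?p' r = 0" if r: "degree r < Suc n" for r
  proof -
    obtain c0 s where rs: "r = pCons c0 s" by (cases r)
    have r2: "r = smult c0 1 + pCons 0 s" by (simp add: rs)
    have ps: "ip p s = 0"
      using orth r by (cases "s = 0") (auto simp: rs)
    have "ip ?p' (pCons 0 s) = 0"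
      using r ps star_orthogonal[OF p, of "pCons 0 s"]
      by (cases "s = 0") (auto simp: rs ip_diff_left ip_smult_left ip_shift1)
    moreover have "ip ?p' 1 = 0"
      using pp by (simp add: ip_diff_left ip_smult_left star_ip_1[OF p])
    ultimately show ?thesis
      unfolding r2 by (simp only: ip_add_right ip_smult_right) simp
  qed
  then show ?thesis
    using deg c by (simp add: is_monic_orthogonal_ip)
qed

lemma monic_orthogonal_0: "is_monic_orthogonal M 0 1"
  by (simp add: is_monic_orthogonal_ip)

lemma monic_OP_eqI: "is_monic_orthogonal M n p \<Longrightarrow> \<Phi> n = p"
  unfolding monic_OP_def by (blast intro: monic_orthogonal_unique)

lemma monic_OP: "is_monic_orthogonal M n (\<Phi> n)"
proof (induction n)
  case 0
  then show ?case using monic_OP_eqI[OF monic_orthogonal_0] monic_orthogonal_0 by simp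
next
  case (Suc n)
  then show ?case using monic_OP_eqI[OF monic_orthogonal_Suc] monic_orthogonal_Suc by simp
qed

lemma degree_OP [simp]: "degree (\<Phi> n) = n"
  and lead_coeff_OP [simp]: "coeff (\<Phi> n) n = 1"
  and OP_orth: "degree r < n \<Longrightarrow> ip (\<Phi> n) r = 0"
  using monic_OP[of n] by (auto simp: is_monic_orthogonal_ip)

lemma OP_nonzero [simp]: "\<Phi> n \<noteq> 0"
  using lead_coeff_OP[of n] by (metis coeff_0 zero_neq_one)

definition \<kappa> :: "nat \<Rightarrow> real" where "\<kappa> n = Re (ip (\<Phi> n) (\<Phi> n))"

lemma kappa_pos: "\<kappa> n > 0"
  unfolding \<kappa>_def by (rule ip_self_pos) simp

lemma ip_OP_self: "ip (\<Phi> n) (\<Phi> n) = of_real (\<kappa> n)"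
  by (simp add: \<kappa>_def ip_self)

abbreviation "\<Phi>s n \<equiv> poly_star n (\<Phi> n)"

text \<open>The scalar of \<open>monic_orthogonal_Suc\<close> is identified by comparing constant
  terms, that of \<open>\<Phi>s n\<close> being 1.\<close>

lemma szego: "\<Phi> (Suc n) = pCons 0 (\<Phi> n) - smult (cnj (\<alpha> n)) (\<Phi>s n)"
  and ip_z_OP: "ip (pCons 0 (\<Phi> n)) 1 = cnj (\<alpha> n) * \<kappa> n"
proof -
  let ?a = "ip (pCons 0 (\<Phi> n)) 1 / ip (\<Phi> n) (\<Phi> n)"
  have *: "\<Phi> (Suc n) = pCons 0 (\<Phi> n) - smult ?a (\<Phi>s n)"
    by (rule monic_OP_eqI[OF monic_orthogonal_Suc[OF monic_OP]])
  have "coeff (\<Phi> (Suc n)) 0 = - ?a"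
    by (subst *) (simp add: coeff_poly_star)
  then have a: "cnj (\<alpha> n) = ?a"
    by (simp add: verblunsky_def poly_0_coeff_0)
  show "\<Phi> (Suc n) = pCons 0 (\<Phi> n) - smult (cnj (\<alpha> n)) (\<Phi>s n)"
    using * a by simp
  show "ip (pCons 0 (\<Phi> n)) 1 = cnj (\<alpha> n) * \<kappa> n"
    using kappa_pos[of n] unfolding a ip_OP_self by simp
qed

lemma ip_star_1: "ip (\<Phi>s n) 1 = \<kappa> n"
  by (simp add: star_ip_1[OF monic_OP] ip_OP_self)

text \<open>Pythagoras for \<open>z * \<Phi> n\<close>, which the recurrence splits into two
  orthogonal parts; multiplication by z and reversal preserve the norm.\<close>

lemma kappa_Suc: "\<kappa> (Suc n) = (1 - (cmod (\<alpha> n))\<^sup>2) * \<kappa> n"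
proof -
  have z: "pCons 0 (\<Phi> n) = \<Phi> (Suc n) + smult (cnj (\<alpha> n)) (\<Phi>s n)"
    by (simp add: szego)
  have o: "ip (\<Phi> (Suc n)) (\<Phi>s n) = 0"
    by (rule OP_orth) (simp add: le_imp_less_Suc degree_poly_star_le)
  have o': "ip (\<Phi>s n) (\<Phi> (Suc n)) = 0"
    using o ip_cnj by (metis complex_cnj_zero)
  have "of_real (\<kappa> n) = ip (pCons 0 (\<Phi> n)) (pCons 0 (\<Phi> n))"
    by (simp add: ip_shift1 ip_OP_self)
  also have "\<dots> = of_real (\<kappa> (Suc n)) + cnj (\<alpha> n) * \<alpha> n * of_real (\<kappa> n)"
    unfolding z
    by (simp add: ip_add_left ip_add_right ip_smult_left ip_smult_right o o' ip_OP_self ip_poly_star_both)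
  also have "cnj (\<alpha> n) * \<alpha> n = of_real ((cmod (\<alpha> n))\<^sup>2)"
    by (simp add: complex_norm_square mult.commute del: of_real_power)
  finally have "complex_of_real (\<kappa> n) = of_real (\<kappa> (Suc n) + (cmod (\<alpha> n))\<^sup>2 * \<kappa> n)"
    by simp
  then show ?thesis
    unfolding of_real_eq_iff by (simp add: algebra_simps)
qed

lemma norm_verblunsky: "cmod (\<alpha> n) < 1"
proof -
  have "(1 - (cmod (\<alpha> n))\<^sup>2) > 0"
    using kappa_Suc[of n] kappa_pos[of n] kappa_pos[of "Suc n"] by (simp add: zero_less_mult_iff)
  then show ?thesis by (simp add: abs_square_less_1)
qed

lemma norm_tau: "cmod (\<tau> n) = 1"
proof (induction n)
  case (Suc n)
  have t: "\<tau> n * cnj (\<tau> n) = 1"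
    using Suc by (simp add: complex_norm_square[symmetric])
  \<comment> \<open>The numerator of \<open>\<tau> (Suc n)\<close> is \<open>\<tau> n\<close> times
    the conjugate of its denominator, so the quotient is unimodular.\<close>
  have e: "\<tau> n - cnj (\<alpha> n) = \<tau> n * cnj (1 - \<tau> n * \<alpha> n)"
    by (simp add: ring_distribs mult.assoc[symmetric] t)
  have "cmod (\<tau> n * \<alpha> n) < 1"
    using Suc norm_verblunsky by (simp add: norm_mult)
  then have "1 - \<tau> n * \<alpha> n \<noteq> 0" by auto
  then show ?case
    by (simp add: e norm_divide norm_mult Suc del: complex_cnj_diff complex_cnj_mult)
qed simp

lemma tau_cnj: "\<tau> n * cnj (\<tau> n) = 1"
  using norm_tau by (simp add: complex_norm_square[symmetric])

lemma norm_tau_verblunsky: "cmod (\<tau> n * \<alpha> n) < 1"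
  by (simp add: norm_mult norm_tau norm_verblunsky)

lemma Re_tau_verblunsky: "Re (\<tau> n * \<alpha> n) < 1"
  using norm_tau_verblunsky complex_Re_le_cmod le_less_trans by blast

lemma tau_verblunsky_ne: "1 - \<tau> n * \<alpha> n \<noteq> 0"
  using norm_tau_verblunsky[of n] by auto

text \<open>The recursion of \<open>tau\<close> is the one that the ratio of \<open>\<Phi> n\<close>
  to \<open>\<Phi>s n\<close> at 1 obeys; this is why \<open>para n\<close> vanishes there.\<close>

lemma poly_OP_1: "poly (\<Phi> n) 1 = \<tau> n * poly (\<Phi>s n) 1"
proof (induction n)
  case 0
  then show ?case
    by (simp add: monic_OP_eqI[OF monic_orthogonal_0] poly_star_def monom_0)
next
  case (Suc n)
  have s: "poly (\<Phi>s m) 1 = cnj (poly (\<Phi> m) 1)" for m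
    by (subst poly_poly_star) auto
  have e: "poly (\<Phi> (Suc n)) 1 = (\<tau> n - cnj (\<alpha> n)) * poly (\<Phi>s n) 1"
    by (simp add: szego Suc ring_distribs)
  have "poly (\<Phi>s (Suc n)) 1 = cnj (poly (\<Phi> n) 1 - cnj (\<alpha> n) * poly (\<Phi>s n) 1)"
    by (simp only: s) (simp add: s szego)
  also have "\<dots> = poly (\<Phi>s n) 1 - \<alpha> n * poly (\<Phi> n) 1"
    by (simp add: s)
  also have "\<dots> = (1 - \<tau> n * \<alpha> n) * poly (\<Phi>s n) 1"
    by (simp add: Suc ring_distribs)
  finally show ?case
    using tau_verblunsky_ne[of n] by (simp add: e)
qed

section \<open>Para-orthogonal polynomials and their quotients by z - 1\<close>

definition para :: "nat \<Rightarrow> complex poly" where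
  "para n = pCons 0 (\<Phi> n) - smult (\<tau> n) (\<Phi>s n)"

text \<open>Up to a nonzero constant this is the polynomial R_n of the three-term recurrence, and
  also the Christoffel-Darboux kernel with second argument 1.\<close>

definition kernel :: "nat \<Rightarrow> complex poly" where
  "kernel n = para n div [:- 1, 1:]"

lemma para_kernel: "para n = [:- 1, 1:] * kernel n"
proof -
  have "poly (para n) 1 = 0" by (simp add: para_def poly_OP_1)
  then have "[:- 1, 1:] dvd para n" by (simp add: poly_eq_0_iff_dvd)
  then show ?thesis unfolding kernel_def by (rule dvd_mult_div_cancel[symmetric])
qed

lemma coeff_para_Suc: "coeff (para n) (Suc n) = 1"
  by (simp add: para_def coeff_poly_star)

lemma coeff_para_0: "coeff (para n) 0 = - \<tau> n"
  by (simp add: para_def coeff_poly_star)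

lemma degree_para: "degree (para n) = Suc n"
proof (rule antisym)
  show "degree (para n) \<le> Suc n"
    unfolding para_def
    by (intro degree_diff_le order.trans[OF degree_smult_le] order.trans[OF degree_poly_star_le]) auto
  show "Suc n \<le> degree (para n)"
    by (rule le_degree) (simp add: coeff_para_Suc)
qed

lemma degree_kernel: "degree (kernel n) = n"
proof -
  have "kernel n \<noteq> 0" using para_kernel[of n] degree_para[of n] by auto
  then have "degree (para n) = degree [:- 1, 1 :: complex:] + degree (kernel n)"
    unfolding para_kernel by (intro degree_mult_eq) auto
  then show ?thesis by (simp add: degree_para)
qed

lemma coeff_kernel_0: "coeff (kernel n) 0 = \<tau> n"
  using coeff_para_0[of n] by (simp add: para_kernel coeff_mult_0)

lemma coeff_kernel_top: "coeff (kernel n) n = 1"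
proof -
  have "coeff (para n) (Suc n) = coeff (kernel n) n - coeff (kernel n) (Suc n)"
    by (simp add: para_kernel)
  then show ?thesis by (simp add: coeff_para_Suc coeff_eq_0 degree_kernel)
qed

text \<open>Multiplication by z moves the orthogonality of \<open>\<Phi> n\<close> from 1, ...,
  z^(n-1) to z, ..., z^n, where \<open>\<Phi>s n\<close> is orthogonal by
  \<open>star_orthogonal\<close>.\<close>

lemma para_orth:
  assumes "1 \<le> j" "j \<le> n"
  shows "ip (monom 1 j) (para n) = 0"
proof -
  obtain i where i: "j = Suc i" using assms by (cases j) auto
  have "ip (\<Phi>s n) (monom 1 j) = 0"
    using assms by (intro star_orthogonal[OF monic_OP]) (auto intro: order.trans[OF degree_monom_le])
  then have a: "ip (monom 1 j) (\<Phi>s n) = 0" by (metis ip_cnj complex_cnj_zero)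
  have "ip (\<Phi> n) (monom 1 i) = 0"
    using assms i by (intro OP_orth) (auto intro: le_less_trans[OF degree_monom_le])
  then have "ip (monom 1 i) (\<Phi> n) = 0" by (metis ip_cnj complex_cnj_zero)
  then have "ip (monom 1 j) (pCons 0 (\<Phi> n)) = 0"
    by (simp add: i monom_Suc ip_shift1)
  with a show ?thesis by (simp add: para_def ip_diff_right ip_smult_right)
qed

lemma ip_1_para: "ip 1 (para n) = (\<alpha> n - cnj (\<tau> n)) * \<kappa> n"
proof -
  have "ip (para n) 1 = (cnj (\<alpha> n) - \<tau> n) * \<kappa> n"
    by (simp add: para_def ip_diff_left ip_smult_left ip_z_OP ip_star_1 ring_distribs)
  then have "cnj (ip (para n) 1) = (\<alpha> n - cnj (\<tau> n)) * \<kappa> n" by simp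
  then show ?thesis by (simp add: ip_cnj)
qed

text \<open>Reversal with index \<open>Suc n\<close> exchanges \<open>z * \<Phi> n\<close> and
  \<open>\<Phi>s n\<close> and conjugates \<open>\<tau> n\<close>.\<close>

lemma star_para: "poly_star (Suc n) (para n) = smult (- cnj (\<tau> n)) (para n)"
proof (rule poly_eqI)
  fix k
  have t: "cnj (\<tau> n) * (\<tau> n * c) = c" for c
    using tau_cnj[of n] by (metis mult.assoc mult.commute mult_1)
  have t1: "cnj (\<tau> n) * \<tau> n = 1"
    using tau_cnj[of n] by (simp add: mult.commute)
  show "coeff (poly_star (Suc n) (para n)) k = coeff (smult (- cnj (\<tau> n)) (para n)) k"
    by (cases k) (auto simp: coeff_poly_star para_def coeff_pCons t t1 coeff_eq_0 Suc_diff_le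
        ring_distribs split: nat.splits intro!: arg_cong[where f = "coeff (\<Phi> n)"])
qed

text \<open>z^(n+1) is the reversal of 1, so \<open>star_para\<close> reduces this pairing to
  \<open>ip_1_para\<close>.\<close>

lemma ip_top_para: "ip (monom 1 (Suc n)) (para n) = (1 - cnj (\<tau> n * \<alpha> n)) * \<kappa> n"
proof -
  have m: "monom 1 (Suc n) = poly_star (Suc n) 1"
    by (intro poly_eqI) (auto simp: coeff_poly_star)
  have "ip (monom 1 (Suc n)) (para n) = ip (poly_star (Suc n) (para n)) 1"
    unfolding m by (rule ip_poly_star) (auto simp: degree_para)
  also have "\<dots> = - cnj (\<tau> n) * cnj (ip 1 (para n))"
    unfolding star_para by (simp only: ip_smult_left ip_cnj)
  also have "\<dots> = (1 - cnj (\<tau> n * \<alpha> n)) * \<kappa> n"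
    using tau_cnj[of n] by (simp add: ip_1_para algebra_simps)
  finally show ?thesis .
qed

text \<open>The interior monomials drop out by \<open>para_orth\<close>. That only the two extreme
  coefficients matter is the source of tridiagonality.\<close>

lemma ip_para:
  assumes "degree p \<le> Suc n"
  shows "ip p (para n) = coeff p 0 * ip 1 (para n) + coeff p (Suc n) * ip (monom 1 (Suc n)) (para n)"
proof -
  have "p = (\<Sum>i\<le>Suc n. smult (coeff p i) (monom 1 i))"
    using poly_as_sum_of_monoms'[OF assms] by (simp add: smult_monom)
  then have "ip p (para n) = (\<Sum>i\<le>Suc n. coeff p i * ip (monom 1 i) (para n))"
    by (metis (no_types, lifting) ip_sum_left ip_smult_left sum.cong)
  also have "\<dots> = (\<Sum>i\<in>{0, Suc n}. coeff p i * ip (monom 1 i) (para n))"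
  proof (rule sum.mono_neutral_right)
    show "\<forall>i\<in>{..Suc n} - {0, Suc n}. coeff p i * ip (monom 1 i) (para n) = 0"
      using para_orth[of _ n] by (auto simp: le_Suc_eq)
  qed auto
  finally show ?thesis by simp
qed

end

section \<open>The tridiagonal form\<close>

text \<open>The parameters split each diagonal entry \<open>b n\<close> into shares
  \<open>g n\<close> and \<open>1 - g n\<close>, which pay for the off-diagonal terms shared with
  the previous and the next index. The bound retains the unspent share of the last entry, which the
  next induction step needs.\<close>

lemma tridiagonal_form_nonneg:
  fixes G :: "nat \<Rightarrow> nat \<Rightarrow> complex" and b g :: "nat \<Rightarrow> real" and y :: "nat \<Rightarrow> complex"
  assumes herm: "\<And>n m. n \<le> m \<Longrightarrow> m \<le> M \<Longrightarrow> G m n = cnj (G n m)"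
    and far: "\<And>n m. Suc n < m \<Longrightarrow> m \<le> M \<Longrightarrow> G n m = 0"
    and diag: "\<And>n. n \<le> M \<Longrightarrow> G n n = of_real (b n)"
    and off: "\<And>n. n < M \<Longrightarrow> (cmod (G n (Suc n)))\<^sup>2 \<le> ((1 - g n) * b n) * (g (Suc n) * b (Suc n))"
    and b: "\<And>n. b n > 0" and g: "0 \<le> g 0" "\<And>n. g n < 1" "\<And>n. 0 < g (Suc n)"
  shows "(1 - g M) * b M * (cmod (y M))\<^sup>2 \<le> Re (\<Sum>n\<le>M. \<Sum>m\<le>M. y n * cnj (y m) * G n m)"
  using herm far diag off
proof (induction M)
  case 0
  have "(1 - g 0) * b 0 * (cmod (y 0))\<^sup>2 \<le> b 0 * (cmod (y 0))\<^sup>2"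
    using g(1) b[of 0] by (intro mult_right_mono) auto
  moreover have "y 0 * cnj (y 0) * G 0 0 = of_real (b 0 * (cmod (y 0))\<^sup>2)"
    using 0(3)[of 0] by (simp add: complex_norm_square[symmetric] del: of_real_power)
  ultimately show ?case by simp
next
  case (Suc M)
  let ?S = "\<Sum>n\<le>M. \<Sum>m\<le>M. y n * cnj (y m) * G n m"
  let ?t = "y M * cnj (y (Suc M)) * G M (Suc M)"
  have IH: "(1 - g M) * b M * (cmod (y M))\<^sup>2 \<le> Re ?S"
    by (rule Suc.IH) (simp_all add: Suc.prems(2-4), rule Suc.prems(1), simp_all)
  have col: "(\<Sum>n\<le>M. y n * cnj (y (Suc M)) * G n (Suc M)) = ?t"
  proof -
    have "(\<Sum>n\<le>M. y n * cnj (y (Suc M)) * G n (Suc M)) = (\<Sum>n\<in>{M}. y n * cnj (y (Suc M)) * G n (Suc M))"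
      by (rule sum.mono_neutral_right) (use Suc.prems(2) in auto)
    then show ?thesis by simp
  qed
  have "(\<Sum>m\<le>M. y (Suc M) * cnj (y m) * G (Suc M) m)
      = cnj (\<Sum>n\<le>M. y n * cnj (y (Suc M)) * G n (Suc M))"
    unfolding cnj_sum by (intro sum.cong refl) (simp add: Suc.prems(1) mult.commute)
  then have row: "(\<Sum>m\<le>M. y (Suc M) * cnj (y m) * G (Suc M) m) = cnj ?t"
    by (simp only: col)
  have last: "y (Suc M) * cnj (y (Suc M)) * G (Suc M) (Suc M) = of_real (b (Suc M) * (cmod (y (Suc M)))\<^sup>2)"
    using Suc.prems(3)[of "Suc M"] by (simp add: complex_norm_square[symmetric] del: of_real_power)
  have split: "(\<Sum>n\<le>Suc M. \<Sum>m\<le>Suc M. y n * cnj (y m) * G n m)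
      = ?S + ?t + (cnj ?t + of_real (b (Suc M) * (cmod (y (Suc M)))\<^sup>2))"
    by (simp only: sum.atMost_Suc sum.distrib col row last add_ac)
  \<comment> \<open>\<open>A\<close> is the share left by the induction hypothesis, \<open>B\<close>
    the share of the new entry. By the arithmetic-geometric mean inequality they dominate
    \<open>?t\<close> and its conjugate.\<close>
  define A B where "A = (1 - g M) * b M" and "B = g (Suc M) * b (Suc M)"
  have pos: "A > 0" "B > 0"
    using g b by (auto simp: A_def B_def)
  have "(cmod (G M (Suc M)))\<^sup>2 \<le> A * B"
    using Suc.prems(4)[of M] by (simp add: A_def B_def)
  then have "cmod (G M (Suc M)) \<le> sqrt A * sqrt B"
    by (metis real_le_rsqrt real_sqrt_mult)
  then have "cmod ?t \<le> (cmod (y M) * cmod (y (Suc M))) * (sqrt A * sqrt B)"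
    by (simp add: norm_mult mult_left_mono)
  moreover have "- cmod ?t \<le> Re ?t"
    using abs_Re_le_cmod[of ?t] by linarith
  moreover have "0 \<le> (sqrt A * cmod (y M) - sqrt B * cmod (y (Suc M)))\<^sup>2"
    by simp
  then have "2 * ((cmod (y M) * cmod (y (Suc M))) * (sqrt A * sqrt B))
      \<le> A * (cmod (y M))\<^sup>2 + B * (cmod (y (Suc M)))\<^sup>2"
    using pos by (simp add: power2_diff power_mult_distrib algebra_simps)
  ultimately have "- (A * (cmod (y M))\<^sup>2 + B * (cmod (y (Suc M)))\<^sup>2) \<le> 2 * Re ?t"
    by linarith
  moreover have "(1 - g (Suc M)) * b (Suc M) * (cmod (y (Suc M)))\<^sup>2
      = b (Suc M) * (cmod (y (Suc M)))\<^sup>2 - B * (cmod (y (Suc M)))\<^sup>2"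
    by (simp add: B_def algebra_simps)
  moreover have re: "Re (u + v + (cnj v + of_real x)) = Re u + 2 * Re v + x" for u v x
    by simp
  ultimately show ?case
    using IH unfolding split re A_def by linarith
qed

section \<open>The weight and its quadratic form\<close>

definition weight :: "real \<Rightarrow> complex \<Rightarrow> real" where
  "weight s z = s * (1 - Re z) - Im z"

definition weight_factor :: "real \<Rightarrow> complex poly" where
  "weight_factor s = [:- Complex s 1, Complex s (- 1):]"

lemma weight_factor:
  assumes "cmod z = 1"
  shows "poly (weight_factor s) z * cnj (z - 1) = of_real (2 * weight s z)"
proof -
  have "Re z * Re z + Im z * Im z = 1"
    using assms by (simp add: cmod_def power2_eq_square)
  then show ?thesis
    by (simp add: weight_factor_def weight_def complex_eq_iff algebra_simps) algebra
qed

declare tau.simps(2) [simp del]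

context circle_measure
begin

text \<open>Twice the weighted inner product (\<open>form_integral\<close>), with the weight split
  between the arguments: the factor z - 1 in the second one turns \<open>kernel\<close> back into
  \<open>para\<close>, whose orthogonality then applies.\<close>

definition form :: "real \<Rightarrow> complex poly \<Rightarrow> complex poly \<Rightarrow> complex" where
  "form s p r = ip (weight_factor s * p) ([:- 1, 1:] * r)"

lemma form_integral: "form s p r = (LINT z|M. of_real (2 * weight s z) * (poly p z * cnj (poly r z)))"
  unfolding form_def ip_def
proof (rule Bochner_Integration.integral_cong)
  fix z assume "z \<in> space M"
  then have w: "poly (weight_factor s) z * cnj (z - 1) = of_real (2 * weight s z)"
    by (intro weight_factor norm_space)
  have e: "poly ([:- 1, 1:] * r) z = (z - 1) * poly r z"
    by (simp add: algebra_simps)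
  show "poly (weight_factor s * p) z * cnj (poly ([:- 1, 1:] * r) z)
      = of_real (2 * weight s z) * (poly p z * cnj (poly r z))"
    unfolding w[symmetric] poly_mult[of "weight_factor s"] e complex_cnj_mult by (simp only: mult_ac)
qed simp

lemma form_cnj: "cnj (form s p r) = form s r p"
  unfolding form_integral Bochner_Integration.integral_cnj[symmetric] by (simp add: mult.commute)

lemma form_self: "form s p p = of_real (2 * (LINT z|M. weight s z * (cmod (poly p z))\<^sup>2))"
proof -
  have "form s p p = (LINT z|M. of_real (2 * (weight s z * (cmod (poly p z))\<^sup>2)))"
    unfolding form_integral
    by (simp add: complex_norm_square[symmetric] mult.assoc del: of_real_power)
  then show ?thesis by (simp only: integral_complex_of_real) simp
qed

lemma form_sum:
  "form s (\<Sum>n\<in>A. smult (y n) (f n)) (\<Sum>m\<in>A. smult (y m) (f m))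
    = (\<Sum>n\<in>A. \<Sum>m\<in>A. y n * cnj (y m) * form s (f n) (f m))"
  unfolding form_def sum_distrib_left ip_sum_left
  by (simp only: ip_sum_right mult_smult_right ip_smult_left ip_smult_right
      sum_distrib_left mult.assoc mult.left_commute[where 'a = complex])

text \<open>Multiplying by a power of \<open>z\<close> does not change \<open>|p|\<close> on the circle, so the Laurent polynomials
  \<open>z\<^sup>-\<^sup>N, \<dots>, z\<^sup>N\<close> are represented by the polynomials of degree at most \<open>2 * N\<close>.\<close>

definition basis :: "nat \<Rightarrow> nat \<Rightarrow> complex poly" where
  "basis N n = monom 1 (N - n div 2) * kernel n"

text \<open>The smaller of the two shifts, \<open>N - m div 2\<close>, is common to both arguments
  and cancels on the circle.\<close>

lemma form_basis:
  assumes "n \<le> m" "m \<le> 2 * N"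
  shows "form s (basis N n) (basis N m)
    = ip (monom 1 (m div 2 - n div 2) * (weight_factor s * kernel n)) (para m)"
proof -
  have le: "n div 2 \<le> m div 2" "m div 2 \<le> N"
    using assms by (auto intro: div_le_mono)
  have m: "monom (1 :: complex) (N - n div 2) = monom 1 (N - m div 2) * monom 1 (m div 2 - n div 2)"
    using le by (simp add: mult_monom)
  have "weight_factor s * basis N n
      = monom 1 (N - m div 2) * (monom 1 (m div 2 - n div 2) * (weight_factor s * kernel n))"
    unfolding basis_def m by (simp only: mult_ac)
  moreover have "[:- 1, 1:] * basis N m = monom 1 (N - m div 2) * para m"
    unfolding basis_def para_kernel by (simp only: mult_ac)
  ultimately show ?thesis
    by (simp only: form_def ip_shift)
qed

lemma degree_weight_kernel: "degree (weight_factor s * kernel n) \<le> Suc n"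
  by (rule order.trans[OF degree_mult_le]) (simp add: degree_kernel weight_factor_def)

lemma coeff_weight_kernel_0: "coeff (weight_factor s * kernel n) 0 = - Complex s 1 * \<tau> n"
  by (simp add: coeff_mult_0 coeff_kernel_0 weight_factor_def)

lemma coeff_weight_kernel_top: "coeff (weight_factor s * kernel n) (Suc n) = Complex s (- 1)"
  by (simp add: weight_factor_def coeff_kernel_top coeff_eq_0 degree_kernel)

text \<open>The polynomial paired with \<open>para m\<close> has degree at most
  \<open>m + 1\<close>, so \<open>ip_para\<close> leaves two terms. On the diagonal both are
  present; for \<open>m = n + 1\<close> only one is, the first for even \<open>n\<close> and the
  second for odd \<open>n\<close>; farther away neither is.\<close>

lemma form_basis_coeffs:
  assumes "n \<le> m" "m \<le> 2 * N"
  defines "\<delta> \<equiv> m div 2 - n div 2"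
  shows "form s (basis N n) (basis N m)
    = (if \<delta> = 0 then - Complex s 1 * \<tau> n else 0) * ip 1 (para m)
      + (if \<delta> + n = m then Complex s (- 1) else 0) * ip (monom 1 (Suc m)) (para m)"
proof -
  have le: "\<delta> + n \<le> m"
    using assms(1) unfolding \<delta>_def by linarith
  let ?p = "monom 1 \<delta> * (weight_factor s * kernel n)"
  have "degree ?p \<le> Suc m"
    using le degree_weight_kernel[of s n] degree_monom_le[of "1 :: complex" \<delta>]
    by (intro order.trans[OF degree_mult_le]) linarith
  moreover have "coeff ?p 0 = (if \<delta> = 0 then - Complex s 1 * \<tau> n else 0)"
    by (simp add: coeff_monom_mult coeff_weight_kernel_0)
  moreover have "coeff ?p (Suc m) = (if \<delta> + n = m then Complex s (- 1) else 0)"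
  proof (cases "\<delta> + n = m")
    case True
    then have "Suc m - \<delta> = Suc n" by simp
    then show ?thesis using True by (simp add: coeff_monom_mult coeff_weight_kernel_top)
  next
    case False
    then have "degree (weight_factor s * kernel n) < Suc m - \<delta>"
      using le degree_weight_kernel[of s n] by linarith
    then show ?thesis using False by (simp add: coeff_monom_mult coeff_eq_0)
  qed
  ultimately show ?thesis
    unfolding form_basis[OF assms(1,2)] \<delta>_def[symmetric] by (simp only: ip_para)
qed

section \<open>Entries of the tridiagonal matrix and completeness of the basis\<close>

abbreviation "\<rho> n \<equiv> 1 - Re (\<tau> n * \<alpha> n)"

lemma form_basis_diag:
  assumes "n \<le> 2 * N"
  shows "form s (basis N n) (basis N n) = of_real (2 * \<kappa> n * \<rho> n * (s - coeff_c M (Suc n)))"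
proof -
  have c: "\<rho> n * coeff_c M (Suc n) = - Im (\<tau> n * \<alpha> n)"
    using Re_tau_verblunsky[of n] by (simp add: coeff_c_def del: times_complex.sel)
  have t: "\<tau> n * (\<alpha> n - cnj (\<tau> n)) = \<tau> n * \<alpha> n - 1"
    by (simp add: right_diff_distrib tau_cnj)
  have "form s (basis N n) (basis N n)
      = - Complex s 1 * (\<tau> n * (\<alpha> n - cnj (\<tau> n))) * \<kappa> n + Complex s (- 1) * (1 - cnj (\<tau> n * \<alpha> n)) * \<kappa> n"
    using form_basis_coeffs[of n n N s] assms by (simp add: ip_1_para ip_top_para mult.assoc)
  also have "\<dots> = of_real (2 * \<kappa> n * (s * \<rho> n + Im (\<tau> n * \<alpha> n)))"
    unfolding t by (simp add: complex_eq_iff algebra_simps del: times_complex.sel) (simp add: algebra_simps)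
  also have "2 * \<kappa> n * (s * \<rho> n + Im (\<tau> n * \<alpha> n)) = 2 * \<kappa> n * \<rho> n * (s - coeff_c M (Suc n))"
    using c by algebra
  finally show ?thesis .
qed

lemma form_basis_far:
  assumes "Suc n < m" "m \<le> 2 * N"
  shows "form s (basis N n) (basis N m) = 0"
proof -
  have "m div 2 - n div 2 \<noteq> 0" "m div 2 - n div 2 + n \<noteq> m"
    using assms(1) by linarith+
  then show ?thesis
    using form_basis_coeffs[of n m N s] assms by simp
qed

text \<open>Whichever of the two terms survives, the modulus is the same: \<open>\<tau> n\<close> is
  unimodular, and \<open>s + i\<close> and \<open>s - i\<close> are conjugate.\<close>

lemma form_basis_off:
  assumes "Suc n \<le> 2 * N"
  shows "(cmod (form s (basis N n) (basis N (Suc n))))\<^sup>2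
    = (s\<^sup>2 + 1) * (cmod (1 - \<tau> (Suc n) * \<alpha> (Suc n)))\<^sup>2 * (\<kappa> (Suc n))\<^sup>2"
proof -
  let ?m = "Suc n"
  have e: "1 - cnj (\<tau> ?m * \<alpha> ?m) = cnj (1 - \<tau> ?m * \<alpha> ?m)"
    by simp
  have "cmod (\<alpha> ?m - cnj (\<tau> ?m)) = cmod (\<tau> ?m * (\<alpha> ?m - cnj (\<tau> ?m)))"
    unfolding norm_mult norm_tau by simp
  also have "\<tau> ?m * (\<alpha> ?m - cnj (\<tau> ?m)) = - (1 - \<tau> ?m * \<alpha> ?m)"
    unfolding right_diff_distrib tau_cnj by simp
  finally have n1: "cmod (ip 1 (para ?m)) = cmod (1 - \<tau> ?m * \<alpha> ?m) * \<kappa> ?m"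
    using kappa_pos[of ?m] unfolding ip_1_para norm_mult norm_minus_cancel by simp
  have n2: "cmod (ip (monom 1 (Suc ?m)) (para ?m)) = cmod (1 - \<tau> ?m * \<alpha> ?m) * \<kappa> ?m"
    using kappa_pos[of ?m] unfolding ip_top_para norm_mult e complex_mod_cnj by simp
  have n3: "cmod (Complex s 1) = sqrt (s\<^sup>2 + 1)" "cmod (Complex s (- 1)) = sqrt (s\<^sup>2 + 1)"
    by (simp_all add: cmod_def)
  consider "Suc n div 2 - n div 2 = 0" | "Suc n div 2 - n div 2 = 1"
    by linarith
  then have "cmod (form s (basis N n) (basis N ?m)) = sqrt (s\<^sup>2 + 1) * (cmod (1 - \<tau> ?m * \<alpha> ?m) * \<kappa> ?m)"
  proof cases
    case 1
    then have "form s (basis N n) (basis N ?m) = - Complex s 1 * \<tau> n * ip 1 (para ?m)"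
      using form_basis_coeffs[of n ?m N s] assms by simp
    then show ?thesis
      by (simp only: norm_mult norm_minus_cancel n1 n3 norm_tau mult_1_right)
  next
    case 2
    then have "form s (basis N n) (basis N ?m) = Complex s (- 1) * ip (monom 1 (Suc ?m)) (para ?m)"
      using form_basis_coeffs[of n ?m N s] assms by simp
    then show ?thesis
      by (simp only: norm_mult n2 n3)
  qed
  then show ?thesis
    by (simp add: power_mult_distrib)
qed

text \<open>Links \<open>coeff_d\<close> to \<open>form_basis_off\<close> through the scalings of
  the diagonal. The two factors are treated apart: \<open>1 - g\<close> times the first scaling is
  \<open>\<kappa> (Suc n)\<close>, and \<open>g\<close> times the second supplies the squared
  modulus.\<close>

lemma coeff_d_eq:
  "coeff_d M (Suc (Suc n)) * (2 * \<kappa> n * \<rho> n) * (2 * \<kappa> (Suc n) * \<rho> (Suc n))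
    = (cmod (1 - \<tau> (Suc n) * \<alpha> (Suc n)))\<^sup>2 * (\<kappa> (Suc n))\<^sup>2"
proof -
  have pos: "\<rho> n > 0" "\<rho> (Suc n) > 0"
    using Re_tau_verblunsky by (auto simp del: times_complex.sel)
  \<comment> \<open>From |1 - w|^2 = 2 (1 - Re w) - (1 - |w|^2) for
    \<open>w = \<tau> n * \<alpha> n\<close>, which has the modulus of
    \<open>\<alpha> n\<close>.\<close>
  have cm: "(cmod (1 - \<tau> n * \<alpha> n))\<^sup>2 = 2 * \<rho> n - (1 - (cmod (\<alpha> n))\<^sup>2)"
  proof -
    have "(cmod (\<alpha> n))\<^sup>2 = (cmod (\<tau> n * \<alpha> n))\<^sup>2"
      by (simp add: norm_mult norm_tau)
    then show ?thesis
      unfolding cmod_power2 by (simp add: power2_eq_square algebra_simps del: times_complex.sel)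
  qed
  have "(1 - coeff_g M (Suc n)) * (2 * \<rho> n) = 1 - (cmod (\<alpha> n))\<^sup>2"
    using pos by (simp add: coeff_g_def cm field_simps del: times_complex.sel)
  moreover have "(1 - coeff_g M (Suc n)) * (2 * \<kappa> n * \<rho> n) = ((1 - coeff_g M (Suc n)) * (2 * \<rho> n)) * \<kappa> n"
    by (simp only: mult_ac)
  ultimately have g1: "(1 - coeff_g M (Suc n)) * (2 * \<kappa> n * \<rho> n) = \<kappa> (Suc n)"
    by (simp only: kappa_Suc)
  have "coeff_g M (Suc (Suc n)) * (2 * \<rho> (Suc n)) = (cmod (1 - \<tau> (Suc n) * \<alpha> (Suc n)))\<^sup>2"
    using pos by (simp add: coeff_g_def field_simps del: times_complex.sel)
  moreover have "coeff_g M (Suc (Suc n)) * (2 * \<kappa> (Suc n) * \<rho> (Suc n))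
      = (coeff_g M (Suc (Suc n)) * (2 * \<rho> (Suc n))) * \<kappa> (Suc n)"
    by (simp only: mult_ac)
  ultimately have g2: "coeff_g M (Suc (Suc n)) * (2 * \<kappa> (Suc n) * \<rho> (Suc n))
      = (cmod (1 - \<tau> (Suc n) * \<alpha> (Suc n)))\<^sup>2 * \<kappa> (Suc n)"
    by (simp only:)
  have "coeff_d M (Suc (Suc n)) * (2 * \<kappa> n * \<rho> n) * (2 * \<kappa> (Suc n) * \<rho> (Suc n))
      = ((1 - coeff_g M (Suc n)) * (2 * \<kappa> n * \<rho> n)) * (coeff_g M (Suc (Suc n)) * (2 * \<kappa> (Suc n) * \<rho> (Suc n)))"
    by (simp add: coeff_d_def mult_ac del: times_complex.sel)
  then show ?thesis
    unfolding g1 g2 by (simp add: power2_eq_square)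
qed

lemma coeff_basis_nz:
  assumes "coeff (basis N n) k \<noteq> 0"
  shows "N - n div 2 \<le> k \<and> k \<le> N - n div 2 + n"
proof -
  have "N - n div 2 \<le> k" "coeff (kernel n) (k - (N - n div 2)) \<noteq> 0"
    using assms by (auto simp: basis_def coeff_monom_mult split: if_splits)
  moreover from this(2) have "k - (N - n div 2) \<le> n"
    using le_degree degree_kernel by metis
  ultimately show ?thesis by linarith
qed

text \<open>The window of exponents grows by one in each step, at the top for even \<open>n\<close>
  and at the bottom for odd \<open>n\<close>. The new basis element has a nonzero coefficient there,
  1 or \<open>\<tau> (Suc n)\<close>, so elimination works.\<close>

lemma basis_span:
  assumes "n \<le> 2 * N" "\<And>k. coeff p k \<noteq> 0 \<Longrightarrow> N - n div 2 \<le> k \<and> k \<le> N - n div 2 + n"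
  shows "\<exists>y. p = (\<Sum>k\<le>n. smult (y k) (basis N k))"
  using assms
proof (induction n arbitrary: p)
  case 0
  have "degree (kernel 0) = 0" by (rule degree_kernel)
  then have k0: "kernel 0 = 1"
    using coeff_kernel_top[of 0] by (metis degree_0_id degree_eq_zeroE coeff_pCons_0 one_pCons)
  have "p = smult (coeff p N) (basis N 0)"
    using 0(2) by (intro poly_eqI) (force simp: basis_def k0)
  then show ?case by auto
next
  case (Suc n)
  \<comment> \<open>\<open>t\<close> is the exponent gained by the window.\<close>
  obtain t where t: "coeff (basis N (Suc n)) t \<noteq> 0"
    and tr: "\<And>k. N - Suc n div 2 \<le> k \<Longrightarrow> k \<le> N - Suc n div 2 + Suc n \<Longrightarrow> k \<noteq> t
        \<Longrightarrow> N - n div 2 \<le> k \<and> k \<le> N - n div 2 + n"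
  proof (cases "even n")
    case True
    then have e: "Suc n div 2 = n div 2" by simp
    show ?thesis
    proof (rule that[of "N - Suc n div 2 + Suc n"])
      show "coeff (basis N (Suc n)) (N - Suc n div 2 + Suc n) \<noteq> 0"
        by (simp add: basis_def coeff_monom_mult coeff_kernel_top)
    qed (use e in auto)
  next
    case False
    then have e: "Suc n div 2 = Suc (n div 2)" by simp
    \<comment> \<open>Guards the truncated subtraction: there is still room for the window to grow
      downwards.\<close>
    then have "Suc (n div 2) \<le> N" using Suc.prems(1) by linarith
    then have e': "N - n div 2 = Suc (N - Suc n div 2)" using e by linarith
    show ?thesis
    proof (rule that[of "N - Suc n div 2"])
      have "\<tau> (Suc n) \<noteq> 0" using norm_tau[of "Suc n"] by (auto simp del: tau.simps)
      then show "coeff (basis N (Suc n)) (N - Suc n div 2) \<noteq> 0"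
        by (simp add: basis_def coeff_monom_mult coeff_kernel_0 del: tau.simps)
      fix k assume "N - Suc n div 2 \<le> k" "k \<le> N - Suc n div 2 + Suc n" "k \<noteq> N - Suc n div 2"
      then show "N - n div 2 \<le> k \<and> k \<le> N - n div 2 + n"
        using e' by (intro conjI; linarith)
    qed
  qed
  define c where "c = coeff p t / coeff (basis N (Suc n)) t"
  let ?p = "p - smult c (basis N (Suc n))"
  have "\<exists>y. ?p = (\<Sum>k\<le>n. smult (y k) (basis N k))"
  proof (rule Suc.IH)
    fix k assume k: "coeff ?p k \<noteq> 0"
    then have "k \<noteq> t" using t by (auto simp: c_def)
    moreover have "coeff p k \<noteq> 0 \<or> coeff (basis N (Suc n)) k \<noteq> 0"
      using k by auto
    ultimately show "N - n div 2 \<le> k \<and> k \<le> N - n div 2 + n"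
      using tr[of k] Suc.prems(2)[of k] coeff_basis_nz[of N "Suc n" k] by blast
  qed (use Suc.prems in auto)
  then obtain y where y: "?p = (\<Sum>k\<le>n. smult (y k) (basis N k))" by blast
  have "p = (\<Sum>k\<le>Suc n. smult ((y(Suc n := c)) k) (basis N k))"
    using y by (simp add: algebra_simps)
  then show ?case by blast
qed

text \<open>The sign \<open>\<sigma>\<close> treats both ends of the arc at once: it makes all
  diagonal entries positive and, having square 1, leaves products of neighbouring entries
  unchanged.\<close>

lemma weighted_square_nonneg:
  fixes q :: "nat \<Rightarrow> real" and s \<sigma> :: real
  assumes \<sigma>: "\<bar>\<sigma>\<bar> = 1"
    and chain: "positive_chain_sequence (\<lambda>n. coeff_d M n / q n)"
    and q: "\<And>n. n \<ge> 1 \<Longrightarrow> q (n + 1) > 0"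
    and sgn: "\<And>n. n \<ge> 1 \<Longrightarrow> \<sigma> * (s - coeff_c M n) > 0"
    and prod: "\<And>n. n \<ge> 1 \<Longrightarrow> q (n + 1) * (s\<^sup>2 + 1) \<le> (s - coeff_c M n) * (s - coeff_c M (n + 1))"
  shows "0 \<le> \<sigma> * (LINT z|M. weight s z * (cmod (poly p z))\<^sup>2)"
proof -
  obtain g where g: "0 \<le> g 1" "g 1 < 1" "\<And>n. n \<ge> 2 \<Longrightarrow> 0 < g n \<and> g n < 1"
    "\<And>n. n \<ge> 1 \<Longrightarrow> coeff_d M (n + 1) / q (n + 1) = (1 - g n) * g (n + 1)"
    using chain unfolding positive_chain_sequence_def by blast
  \<comment> \<open>For this \<open>N\<close> the window of index \<open>2 * N\<close> is 0, ..., 2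
    N and contains all exponents of \<open>p\<close>.\<close>
  define N where "N = degree p"
  have "\<exists>y. p = (\<Sum>k\<le>2 * N. smult (y k) (basis N k))"
    by (rule basis_span) (auto simp: N_def dest: le_degree)
  then obtain y where y: "p = (\<Sum>k\<le>2 * N. smult (y k) (basis N k))" by blast
  define b where "b n = \<sigma> * (2 * \<kappa> n * \<rho> n * (s - coeff_c M (Suc n)))" for n
  \<comment> \<open>Chain parameters are indexed from 1, basis elements from 0.\<close>
  define h where "h n = g (Suc n)" for n
  let ?G = "\<lambda>n m. of_real \<sigma> * form s (basis N n) (basis N m)"
  have \<rho>: "\<rho> n > 0" for n
    using Re_tau_verblunsky[of n] by (simp del: times_complex.sel)
  have \<sigma>2: "\<sigma> * \<sigma> = 1"
    using \<sigma> by (metis abs_mult_self_eq mult_1)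
  have bpos: "b n > 0" for n
  proof -
    have "b n = (2 * \<kappa> n * \<rho> n) * (\<sigma> * (s - coeff_c M (Suc n)))"
      by (simp add: b_def mult_ac del: times_complex.sel)
    moreover have "2 * \<kappa> n * \<rho> n > 0"
      using kappa_pos[of n] \<rho>[of n] by simp
    then have "(2 * \<kappa> n * \<rho> n) * (\<sigma> * (s - coeff_c M (Suc n))) > 0"
      by (rule mult_pos_pos) (use sgn[of "Suc n"] in simp)
    ultimately show ?thesis by simp
  qed
  have off: "(cmod (?G n (Suc n)))\<^sup>2 \<le> ((1 - h n) * b n) * (h (Suc n) * b (Suc n))"
    if "n < 2 * N" for n
  proof -
    have qp: "q (Suc (Suc n)) > 0" using q[of "Suc n"] by simp
    have d: "coeff_d M (Suc (Suc n)) = q (Suc (Suc n)) * ((1 - h n) * h (Suc n))"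
      using g(4)[of "Suc n"] qp by (simp add: h_def field_simps)
    let ?K = "(2 * \<kappa> n * \<rho> n) * (2 * \<kappa> (Suc n) * \<rho> (Suc n))"
    have K: "?K > 0"
      using kappa_pos \<rho> by (intro mult_pos_pos) (auto simp del: times_complex.sel)
    have h: "h n < 1" "0 < h (Suc n)"
      using g(2) g(3)[of "Suc n"] g(3)[of "Suc (Suc n)"] by (cases n; auto simp: h_def)+
    have nn: "0 \<le> ((1 - h n) * h (Suc n)) * ?K"
      by (rule mult_nonneg_nonneg[OF _ less_imp_le[OF K]]) (use h in simp)
    have "(cmod (?G n (Suc n)))\<^sup>2 = (s\<^sup>2 + 1) * (coeff_d M (Suc (Suc n)) * ?K)"
      using form_basis_off[of n N s] that coeff_d_eq[of n] \<sigma>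
      by (simp add: norm_mult mult.assoc del: times_complex.sel)
    \<comment> \<open>Writing \<open>coeff_d\<close> as \<open>q\<close> times its chain parameters
      produces the left side of \<open>prod\<close>.\<close>
    also have "\<dots> = (q (Suc (Suc n)) * (s\<^sup>2 + 1)) * (((1 - h n) * h (Suc n)) * ?K)"
      unfolding d by (simp only: mult_ac)
    also have "\<dots> \<le> ((s - coeff_c M (Suc n)) * (s - coeff_c M (Suc (Suc n)))) * (((1 - h n) * h (Suc n)) * ?K)"
      using prod[of "Suc n"] nn by (intro mult_right_mono) auto
    also have "\<dots> = (\<sigma> * \<sigma>) * (((s - coeff_c M (Suc n)) * (s - coeff_c M (Suc (Suc n)))) * (((1 - h n) * h (Suc n)) * ?K))"
      by (simp only: \<sigma>2 mult_1)
    also have "\<dots> = ((1 - h n) * b n) * (h (Suc n) * b (Suc n))"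
      unfolding b_def by (simp only: mult_ac)
    finally show ?thesis .
  qed
  have "(1 - h (2 * N)) * b (2 * N) * (cmod (y (2 * N)))\<^sup>2
      \<le> Re (\<Sum>n\<le>2 * N. \<Sum>m\<le>2 * N. y n * cnj (y m) * ?G n m)"
  proof (rule tridiagonal_form_nonneg)
    show "h n < 1" for n
      using g(2) g(3)[of "Suc n"] by (cases n) (auto simp: h_def)
    show "0 < h (Suc n)" for n
      using g(3)[of "Suc (Suc n)"] by (simp add: h_def)
    show "0 \<le> h 0" using g(1) by (simp add: h_def)
    show "?G n n = of_real (b n)" if "n \<le> 2 * N" for n
      using form_basis_diag[OF that, of s] by (simp add: b_def del: times_complex.sel)
    show "?G m n = cnj (?G n m)" for n m
      by (simp only: complex_cnj_mult form_cnj complex_cnj_complex_of_real)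
    show "?G n m = 0" if "Suc n < m" "m \<le> 2 * N" for n m
      by (simp only: form_basis_far[OF that] mult_zero_right)
  qed (fact bpos off)+
  also have "(\<Sum>n\<le>2 * N. \<Sum>m\<le>2 * N. y n * cnj (y m) * ?G n m) = of_real \<sigma> * form s p p"
  proof -
    have "form s p p = (\<Sum>n\<le>2 * N. \<Sum>m\<le>2 * N. y n * cnj (y m) * form s (basis N n) (basis N m))"
      using form_sum[of s y "basis N" "{..2 * N}"] by (simp only: y[symmetric])
    then show ?thesis
      by (simp only: sum_distrib_left mult.left_commute[of _ "of_real \<sigma>"])
  qed
  also have "Re \<dots> = \<sigma> * (2 * (LINT z|M. weight s z * (cmod (poly p z))\<^sup>2))"
    by (simp add: form_self)
  finally have *: "(1 - h (2 * N)) * b (2 * N) * (cmod (y (2 * N)))\<^sup>2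
      \<le> \<sigma> * (2 * (LINT z|M. weight s z * (cmod (poly p z))\<^sup>2))" .
  moreover have "0 \<le> (1 - h (2 * N)) * b (2 * N) * (cmod (y (2 * N)))\<^sup>2"
    using bpos[of "2 * N"] g(2) g(3)[of "Suc (2 * N)"]
    by (intro mult_nonneg_nonneg) (cases N; auto simp: h_def)+
  ultimately show ?thesis by simp
qed

end

section \<open>From the form to null arcs\<close>

text \<open>On the circle these are the real trigonometric polynomials. The factor
  \<open>z ^ N\<close> clears negative powers without changing the modulus, so the square of such a
  function is the squared modulus of a polynomial.\<close>

definition circle_trig_fun :: "(complex \<Rightarrow> real) set" where
  "circle_trig_fun = {f. continuous_on (sphere 0 1) f \<and>
     (\<exists>N p. \<forall>z\<in>sphere 0 1. of_real (f z) * z ^ N = poly p z)}"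

lemma circle_trig_funI:
  assumes "continuous_on (sphere 0 1) f"
    and "\<And>z. z \<in> sphere 0 1 \<Longrightarrow> of_real (f z) * z ^ N = poly p z"
  shows "f \<in> circle_trig_fun"
  using assms unfolding circle_trig_fun_def by blast

text \<open>Supplies the hypotheses of Stone-Weierstrass. Points are separated by \<open>Re\<close>
  and \<open>Im\<close>, which become polynomials after multiplication by z because
  \<open>cnj z * z = 1\<close>.\<close>

lemma circle_trig_fun_ring: "function_ring_on circle_trig_fun (sphere 0 1)"
proof
  fix f g assume "f \<in> circle_trig_fun" "g \<in> circle_trig_fun"
  then obtain N p N' p' where c: "continuous_on (sphere 0 1) f" "continuous_on (sphere 0 1) g"
    and p: "\<forall>z\<in>sphere 0 1. of_real (f z) * z ^ N = poly p z"
    and p': "\<forall>z\<in>sphere 0 1. of_real (g z) * z ^ N' = poly p' z"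
    by (auto simp: circle_trig_fun_def)
  have "\<forall>z\<in>sphere 0 1. of_real (f z + g z) * z ^ (N + N') = poly (p * monom 1 N' + p' * monom 1 N) z"
    using p p' by (simp add: poly_monom power_add distrib_right mult.assoc[symmetric])
  then show "(\<lambda>z. f z + g z) \<in> circle_trig_fun"
    unfolding circle_trig_fun_def using c by (blast intro: continuous_intros)
  have "\<forall>z\<in>sphere 0 1. of_real (f z * g z) * z ^ (N + N') = poly (p * p') z"
    using p p' by (auto simp: power_add mult_ac dest!: bspec sym[of _ "poly _ _"])
  then show "(\<lambda>z. f z * g z) \<in> circle_trig_fun"
    unfolding circle_trig_fun_def using c by (blast intro: continuous_intros)
next
  fix c :: real
  have "\<forall>z\<in>sphere 0 1. of_real c * z ^ 0 = poly [:of_real c:] z" by simp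
  then show "(\<lambda>_. c) \<in> circle_trig_fun"
    unfolding circle_trig_fun_def by (blast intro: continuous_intros)
next
  fix x y :: complex assume "x \<noteq> y"
  then have "Re x \<noteq> Re y \<or> Im x \<noteq> Im y" by (simp add: complex_eq_iff)
  moreover have sq: "cnj z * z = 1" if "z \<in> sphere 0 1" for z
    using that by (simp add: mult.commute flip: complex_norm_square)
  have "of_real (Re z) * z ^ 1 = poly [:1 / 2, 0, 1 / 2:] z" if "z \<in> sphere 0 1" for z
  proof -
    have "of_real (Re z) = (z + cnj z) / 2" by (simp add: complex_add_cnj)
    then show ?thesis using sq[OF that] by (simp add: field_simps)
  qed
  then have "Re \<in> circle_trig_fun"
    by (intro circle_trig_funI continuous_intros)
  moreover have "of_real (Im z) * z ^ 1 = poly [:\<i> / 2, 0, - \<i> / 2:] z" if "z \<in> sphere 0 1" for z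
  proof -
    have "of_real (Im z) = \<i> / 2 * (cnj z - z)" by (simp add: complex_eq_iff)
    then have "of_real (Im z) * z = \<i> / 2 * (cnj z * z - z * z)"
      by (simp only: left_diff_distrib mult.assoc)
    then show ?thesis unfolding sq[OF that] by (simp add: algebra_simps)
  qed
  then have "Im \<in> circle_trig_fun"
    by (intro circle_trig_funI continuous_intros)
  ultimately show "\<exists>f\<in>circle_trig_fun. f x \<noteq> f y" by blast
qed (auto simp: circle_trig_fun_def)

lemma continuous_on_weight [continuous_intros]: "continuous_on A (weight s)"
  unfolding weight_def by (intro continuous_intros)

context circle_measure
begin

text \<open>Uniform approximation extends the hypothesis from polynomials to a continuous function
  that lives only where the claim fails.\<close>

lemma weight_AE_nonneg:
  fixes \<sigma> :: real
  assumes nonneg: "\<And>p. 0 \<le> \<sigma> * (LINT z|M. weight s z * (cmod (poly p z))\<^sup>2)"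
  shows "AE z in M. 0 \<le> \<sigma> * weight s z"
proof -
  interpret SW: function_ring_on circle_trig_fun "sphere 0 1"
    by (rule circle_trig_fun_ring)
  \<comment> \<open>testing with \<open>h\<^sup>2\<close>, the negative part of the weight, turns the integrand into minus a square\<close>
  define h where "h z = sqrt (max 0 (- (\<sigma> * weight s z)))" for z
  have hc: "continuous_on A h" for A
    unfolding h_def by (intro continuous_intros)
  \<comment> \<open>For \<open>e < 1\<close>, an approximation of \<open>h\<close> within
    \<open>e\<close> changes its square by at most \<open>e * (2 * |h| + 1)\<close>, hence the
    integral by at most \<open>e * C\<close>.\<close>
  define C where "C = (LINT z|M. \<bar>\<sigma> * weight s z\<bar> * (2 * \<bar>h z\<bar> + 1))"
  have C0: "0 \<le> C" unfolding C_def by simp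
  have approx: "- (e * C) \<le> (LINT z|M. \<sigma> * weight s z * (h z)\<^sup>2)" if e: "0 < e" "e < 1" for e
  proof -
    obtain f where f: "f \<in> circle_trig_fun" "\<forall>z\<in>sphere 0 1. \<bar>h z - f z\<bar> < e"
      using SW.Stone_Weierstrass_basic[OF hc e(1)] by blast
    from f(1) have fc: "continuous_on (sphere 0 1) f"
      and "\<exists>N p. \<forall>z\<in>sphere 0 1. of_real (f z) * z ^ N = poly p z"
      by (simp_all add: circle_trig_fun_def)
    then obtain N p where p: "\<And>z. z \<in> sphere 0 1 \<Longrightarrow> of_real (f z) * z ^ N = poly p z"
      by blast
    have fp: "(cmod (poly p z))\<^sup>2 = (f z)\<^sup>2" if "z \<in> space M" for z
      using p[of z] that by (simp add: space_M norm_mult norm_power flip: p)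
    have "(LINT z|M. weight s z * (cmod (poly p z))\<^sup>2) = (LINT z|M. weight s z * (f z)\<^sup>2)"
      by (rule Bochner_Integration.integral_cong) (simp_all add: fp)
    then have "0 \<le> \<sigma> * (LINT z|M. weight s z * (f z)\<^sup>2)"
      using nonneg[of p] by simp
    then have "0 \<le> (LINT z|M. \<sigma> * weight s z * (f z)\<^sup>2)"
      by (simp add: mult.assoc)
    moreover have "(LINT z|M. \<sigma> * weight s z * (f z)\<^sup>2 - e * (\<bar>\<sigma> * weight s z\<bar> * (2 * \<bar>h z\<bar> + 1)))
        \<le> (LINT z|M. \<sigma> * weight s z * (h z)\<^sup>2)"
    proof (rule integral_mono)
      fix z assume z: "z \<in> space M"
      then have "\<bar>h z - f z\<bar> < e"
        using f(2) unfolding space_M by blast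
      then have d: "\<bar>f z - h z\<bar> \<le> e" by linarith
      have "\<bar>(f z)\<^sup>2 - (h z)\<^sup>2\<bar> = \<bar>f z - h z\<bar> * \<bar>f z + h z\<bar>"
        by (simp add: power2_eq_square square_diff_square_factored abs_mult mult.commute)
      also have "\<dots> \<le> e * (2 * \<bar>h z\<bar> + 1)"
        using d e by (intro mult_mono) auto
      finally have "\<bar>\<sigma> * weight s z\<bar> * \<bar>(f z)\<^sup>2 - (h z)\<^sup>2\<bar> \<le> \<bar>\<sigma> * weight s z\<bar> * (e * (2 * \<bar>h z\<bar> + 1))"
        by (intro mult_left_mono) auto
      then have "\<bar>\<sigma> * weight s z * ((f z)\<^sup>2 - (h z)\<^sup>2)\<bar> \<le> e * (\<bar>\<sigma> * weight s z\<bar> * (2 * \<bar>h z\<bar> + 1))"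
        by (simp only: abs_mult mult_ac)
      then have "\<sigma> * weight s z * ((f z)\<^sup>2 - (h z)\<^sup>2) \<le> e * (\<bar>\<sigma> * weight s z\<bar> * (2 * \<bar>h z\<bar> + 1))"
        by linarith
      then show "\<sigma> * weight s z * (f z)\<^sup>2 - e * (\<bar>\<sigma> * weight s z\<bar> * (2 * \<bar>h z\<bar> + 1))
          \<le> \<sigma> * weight s z * (h z)\<^sup>2"
        by (simp only: right_diff_distrib)
    qed (intro integrable_cont continuous_intros fc hc)+
    moreover have "(LINT z|M. \<sigma> * weight s z * (f z)\<^sup>2 - e * (\<bar>\<sigma> * weight s z\<bar> * (2 * \<bar>h z\<bar> + 1)))
        = (LINT z|M. \<sigma> * weight s z * (f z)\<^sup>2) - e * C"
      unfolding C_def by (subst Bochner_Integration.integral_diff)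
        (intro integrable_cont continuous_intros fc hc | simp only: integral_mult_right_zero)+
    ultimately show ?thesis by linarith
  qed
  have "0 \<le> (LINT z|M. \<sigma> * weight s z * (h z)\<^sup>2)"
  proof (rule ccontr)
    let ?I = "LINT z|M. \<sigma> * weight s z * (h z)\<^sup>2"
    assume neg: "\<not> 0 \<le> ?I"
    \<comment> \<open>Below 1 and so small that \<open>e * C\<close> is at most half of
      \<open>- ?I\<close>; \<open>C + 1\<close> avoids a division by zero.\<close>
    define e where "e = min (1 / 2) (- ?I / (2 * (C + 1)))"
    have e: "0 < e" "e < 1" using neg C0 by (auto simp: e_def divide_neg_pos)
    have "e * C \<le> e * (C + 1)" using e by simp
    also have "\<dots> \<le> (- ?I / (2 * (C + 1))) * (C + 1)"
      using C0 by (intro mult_right_mono) (auto simp: e_def)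
    also have "\<dots> = - ?I / 2" using C0 by (simp add: field_simps)
    finally show False using approx[OF e] neg by linarith
  qed
  moreover have e: "\<sigma> * weight s z * (h z)\<^sup>2 = - (max 0 (- (\<sigma> * weight s z)))\<^sup>2" for z
    by (auto simp: h_def max_def power2_eq_square)
  ultimately have "(LINT z|M. (max 0 (- (\<sigma> * weight s z)))\<^sup>2) \<le> 0"
    by simp
  moreover have "0 \<le> (LINT z|M. (max 0 (- (\<sigma> * weight s z)))\<^sup>2)"
    by simp
  ultimately have "(LINT z|M. (max 0 (- (\<sigma> * weight s z)))\<^sup>2) = 0"
    by linarith
  moreover have "integrable M (\<lambda>z. (max 0 (- (\<sigma> * weight s z)))\<^sup>2)"
    by (intro integrable_cont continuous_intros)
  ultimately have "AE z in M. (max 0 (- (\<sigma> * weight s z)))\<^sup>2 = 0"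
    by (subst (asm) integral_nonneg_eq_0_iff_AE) auto
  then show ?thesis
    by eventually_elim (auto simp: max_def split: if_splits)
qed

text \<open>Within \<open>U\<close> the measure is carried by the point 1 at most, so removing the
  atom there leaves \<open>U\<close> with mass zero. This serves for \<open>z = 1\<close> as well as
  for the other points.\<close>

lemma not_in_support_diff:
  assumes U: "open U" "z \<in> U" and ae: "AE w in M. w \<in> U \<longrightarrow> w = 1"
  shows "z \<notin> msupport (diff_measure M (scale_measure (emeasure M {1}) (return M 1)))"
proof -
  let ?N = "scale_measure (emeasure M {1}) (return M 1)"
  have one: "{1} \<in> sets M"
    using sets_Int_space[of "{1}"] by (simp add: space_M)
  have A: "U \<inter> space M \<in> sets M"
    using U by (intro sets_Int_space borel_open)
  have N: "emeasure ?N B = emeasure M {1} * indicator B 1" if "B \<in> sets M" for B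
    using that by simp
  \<comment> \<open>Finiteness and domination, shown next, allow the difference measure to be
    evaluated by subtraction.\<close>
  have fin: "finite_measure ?N"
  proof
    have "emeasure ?N (space ?N) = emeasure M {1} * indicator (space M) 1"
      unfolding space_scale_measure space_return by (rule N[OF sets.top])
    then show "emeasure ?N (space ?N) \<noteq> \<infinity>"
      by (simp only:) (simp add: emeasure_eq_measure indicator_def)
  qed
  have le: "emeasure ?N B \<le> emeasure M B" if "B \<in> sets M" for B
    using that one unfolding N[OF that]
    by (auto simp: indicator_def intro!: emeasure_mono)
  have "emeasure M (U \<inter> space M) = emeasure M {1} * indicator (U \<inter> space M) 1"
  proof (cases "1 \<in> U \<inter> space M")
    case True
    have "AE w in M. w \<in> U \<inter> space M \<longleftrightarrow> w \<in> {1}"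
      using ae by eventually_elim (use True in auto)
    then have "emeasure M (U \<inter> space M) = emeasure M {1}"
      using A one by (intro emeasure_eq_AE)
    then show ?thesis using True by simp
  next
    case False
    have "AE w in M. w \<in> U \<inter> space M \<longleftrightarrow> w \<in> {}"
      using ae by eventually_elim (use False in auto)
    then have "emeasure M (U \<inter> space M) = emeasure M {}"
      using A by (intro emeasure_eq_AE) auto
    then show ?thesis using False by simp
  qed
  then have "emeasure (diff_measure M ?N) (U \<inter> space M) = 0"
    using A le fin finite_measure_axioms
    by (subst emeasure_diff_measure) (auto simp: N emeasure_eq_measure indicator_def)
  then show ?thesis
    using U by (auto simp: msupport_def)
qed

end

section \<open>Roots and inverse cotangent\<close>

text \<open>The discriminant is a sum of nonnegative terms, so both roots are real; the
  factorisation follows from their sum and product.\<close>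

lemma u_roots_factor:
  fixes a b q :: real
  assumes q: "0 < q" "q < 1"
  obtains x y where "u_roots a b q = {x, y}"
    "\<And>u. (1 - q) * u\<^sup>2 - (a + b) * u + a * b - q = (1 - q) * ((u - x) * (u - y))"
proof -
  define D where "D = (a + b)\<^sup>2 - 4 * (1 - q) * (a * b - q)"
  have "D = (1 - q) * (a - b)\<^sup>2 + q * (a + b)\<^sup>2 + 4 * q * (1 - q)"
    by (simp add: D_def power2_eq_square algebra_simps)
  then have D: "0 \<le> D" using q by simp
  define x y where "x = ((a + b) - sqrt D) / (2 * (1 - q))" and "y = ((a + b) + sqrt D) / (2 * (1 - q))"
  have xy: "2 * (1 - q) * x = (a + b) - sqrt D" "2 * (1 - q) * y = (a + b) + sqrt D"
    using q by (simp_all add: x_def y_def)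
  have "2 * ((1 - q) * (x + y)) = 2 * (1 - q) * x + 2 * (1 - q) * y"
    by (simp add: algebra_simps)
  then have 1: "(1 - q) * (x + y) = a + b"
    unfolding xy by simp
  have "4 * (1 - q) * ((1 - q) * (x * y)) = (2 * (1 - q) * x) * (2 * (1 - q) * y)"
    by algebra
  also have "\<dots> = (a + b)\<^sup>2 - D"
    unfolding xy using D by (simp add: algebra_simps power2_eq_square)
  also have "\<dots> = 4 * (1 - q) * (a * b - q)"
    by (simp add: D_def)
  finally have 2: "(1 - q) * (x * y) = a * b - q"
    using q by simp
  have fac: "(1 - q) * u\<^sup>2 - (a + b) * u + a * b - q = (1 - q) * ((u - x) * (u - y))" for u
  proof -
    have "(1 - q) * ((u - x) * (u - y)) = (1 - q) * u\<^sup>2 - ((1 - q) * (x + y)) * u + (1 - q) * (x * y)"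
      by (simp add: power2_eq_square algebra_simps)
    then show ?thesis unfolding 1 2 by simp
  qed
  have "u_roots a b q = {x, y}"
    using q unfolding u_roots_def fac by auto
  then show thesis using fac by (rule that)
qed

lemma u_roots_uminus: "u_roots (- a) (- b) q = uminus ` u_roots a b q"
proof -
  have "u \<in> u_roots (- a) (- b) q \<longleftrightarrow> - u \<in> u_roots a b q" for u
    by (simp add: u_roots_def algebra_simps)
  then show ?thesis by (force simp: image_iff)
qed

text \<open>The reflection of \<open>u\<close>, \<open>a\<close> and \<open>b\<close> in 0 preserves
  the equation; it reduces the lower end of the arc to the upper one.\<close>

lemma u_minus_uminus:
  assumes "0 < q" "q \<le> 1"
  shows "u_minus a b q = - u_plus (- a) (- b) q"
proof (cases "q = 1")
  case True
  then show ?thesis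
    by (auto simp: u_minus_def u_plus_def divide_minus_right[symmetric] simp del: divide_minus_right)
next
  case False
  then have "finite (u_roots a b q)" "u_roots a b q \<noteq> {}"
    using assms u_roots_factor[of q a b] by (metis finite.intros insert_not_empty less_le)+
  then show ?thesis
    using False by (simp add: u_minus_def u_plus_def u_roots_uminus flip: minus_Min_eq_Max)
qed

text \<open>The quadratic equals \<open>(u - a) * (u - b) - q * (u^2 + 1)\<close>. It is nonnegative
  from \<open>u_plus\<close> onwards but negative at \<open>u = a\<close>, so \<open>a\<close> lies
  to the left of \<open>s\<close>.\<close>

lemma u_plus_bound:
  fixes a b q s :: real
  assumes q: "0 < q" "q \<le> 1" and le: "u_plus a b q \<le> ereal s"
  shows "a < s" "q * (s\<^sup>2 + 1) \<le> (s - a) * (s - b)"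
proof -
  have id: "(u - a) * (u - b) - q * (u\<^sup>2 + 1) = (1 - q) * u\<^sup>2 - (a + b) * u + a * b - q" for u
    by (simp add: power2_eq_square algebra_simps)
  have key: "0 \<le> (u - a) * (u - b) - q * (u\<^sup>2 + 1)" if u: "u_plus a b q \<le> ereal u" for u
  proof (cases "q = 1")
    case True
    \<comment> \<open>A finite value of \<open>u_plus\<close> leaves only \<open>a + b < 0\<close>,
      where the linear function is increasing.\<close>
    then have "a + b < 0" "(a * b - 1) / (a + b) \<le> u"
      using u by (auto simp: u_plus_def split: if_splits)
    then have "u * (a + b) \<le> a * b - 1" by (simp add: neg_divide_le_eq)
    then show ?thesis unfolding id using True by (simp add: algebra_simps)
  next
    case False
    have q1: "q < 1" using False q by simp
    from u_roots_factor[OF q(1) q1, of a b] obtain x y where r: "u_roots a b q = {x, y}"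
      and fac: "(1 - q) * u\<^sup>2 - (a + b) * u + a * b - q = (1 - q) * ((u - x) * (u - y))"
      by metis
    then have "Max {x, y} \<le> u" using u False by (simp add: u_plus_def)
    then have u': "x \<le> u" "y \<le> u" by simp_all
    have "0 \<le> (1 - q) * ((u - x) * (u - y))"
      using q1 u' by simp
    then show ?thesis unfolding id fac .
  qed
  show "q * (s\<^sup>2 + 1) \<le> (s - a) * (s - b)"
    using key[OF le] by simp
  show "a < s"
  proof (rule ccontr)
    assume "\<not> a < s"
    then have "u_plus a b q \<le> ereal a" using le by (meson ereal_less_eq(3) not_less order_trans)
    moreover have "0 < q * (a\<^sup>2 + 1)"
      using q by (intro mult_pos_pos) (auto intro: add_nonneg_pos)
    ultimately show False using key[of a] by simp
  qed
qed

lemma u_minus_bound: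
  fixes a b q s :: real
  assumes q: "0 < q" "q \<le> 1" and le: "ereal s \<le> u_minus a b q"
  shows "s < a" "q * (s\<^sup>2 + 1) \<le> (s - a) * (s - b)"
proof -
  have "u_plus (- a) (- b) q \<le> ereal (- s)"
    using le unfolding u_minus_uminus[OF q]
    by (metis ereal_minus_le_minus ereal_uminus_uminus uminus_ereal.simps(1))
  from u_plus_bound[OF q this] show "s < a" "q * (s\<^sup>2 + 1) \<le> (s - a) * (s - b)"
    by (simp_all add: algebra_simps)
qed

section \<open>The inverse cotangent and the sign of the weight on the circle\<close>

lemma cot_eq_tan: "cot t = tan (pi / 2 - t)" for t :: real
  by (simp add: cot_def tan_def sin_diff cos_diff)

lemma arccot_ereal: "arccot (ereal x) = pi / 2 - arctan x"
proof -
  have "(THE t. 0 < t \<and> t < pi \<and> cot t = x) = pi / 2 - arctan x"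
  proof (rule the_equality)
    show "0 < pi / 2 - arctan x \<and> pi / 2 - arctan x < pi \<and> cot (pi / 2 - arctan x) = x"
      using arctan_bounded[of x] by (simp add: cot_eq_tan tan_arctan)
    fix t assume "0 < t \<and> t < pi \<and> cot t = x"
    then have "arctan x = pi / 2 - t"
      by (intro arctan_unique) (auto simp: cot_eq_tan)
    then show "t = pi / 2 - arctan x" by simp
  qed
  then show ?thesis by (simp add: arccot_def)
qed

lemma weight_cis: "weight s (cis (2 * t)) = 2 * sin t * (s * sin t - cos t)"
  unfolding weight_def cis.sel cos_double_sin sin_double by algebra

text \<open>At the angle \<open>2 * t\<close> the weight has the sign of \<open>s - cot t\<close>,
  and the cotangent decreases on (0, pi).\<close>

lemma weight_cis_neg:
  assumes "0 < t" "t < arccot (ereal s)"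
  shows "weight s (cis (2 * t)) < 0"
proof -
  have t: "t < pi" "arctan s < pi / 2 - t" "pi / 2 - t < pi / 2"
    using assms arctan_bounded[of s] by (simp_all add: arccot_ereal)
  have sin: "0 < sin t" using assms t by (simp add: sin_gt_zero)
  have "tan (arctan s) < tan (pi / 2 - t)"
    using t arctan_bounded[of s] by (intro tan_monotone) auto
  then have "s < cos t / sin t"
    by (simp add: tan_arctan cot_eq_tan[symmetric] cot_def)
  then have "s * sin t < cos t" using sin by (simp add: pos_less_divide_eq)
  then show ?thesis using sin unfolding weight_cis by (simp add: mult_pos_neg)
qed

lemma weight_cis_pos:
  assumes "arccot (ereal s) < t" "t < pi"
  shows "0 < weight s (cis (2 * t))"
proof -
  have t: "0 < t" "pi / 2 - t < arctan s" "- (pi / 2) < pi / 2 - t"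
    using assms arctan_bounded[of s] by (simp_all add: arccot_ereal)
  have sin: "0 < sin t" using assms t by (simp add: sin_gt_zero)
  have "tan (pi / 2 - t) < tan (arctan s)"
    using t arctan_bounded[of s] by (intro tan_monotone) auto
  then have "cos t / sin t < s"
    by (simp add: tan_arctan cot_eq_tan[symmetric] cot_def)
  then have "cos t < s * sin t" using sin by (simp add: pos_divide_less_eq)
  then show ?thesis using sin unfolding weight_cis by simp
qed

text \<open>On the circle near 1, \<open>1 - Re z\<close> is at most the square of
  \<open>Im z\<close>, so \<open>- Im z\<close> decides the sign of both weights. This isolates 1
  from the rest of the support when both ends are finite.\<close>

lemma eq_one_near_one:
  fixes s i :: real
  assumes "cmod z = 1" "Re z > 0" "\<bar>s\<bar> * \<bar>Im z\<bar> < 1" "\<bar>i\<bar> * \<bar>Im z\<bar> < 1"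
    and "0 \<le> weight s z" "weight i z \<le> 0"
  shows "z = 1"
proof -
  have "(Re z)\<^sup>2 + (Im z)\<^sup>2 = 1"
    using assms(1) by (simp add: cmod_def)
  then have e: "(1 - Re z) * (1 + Re z) = (Im z)\<^sup>2"
    by (simp add: power2_eq_square algebra_simps)
  have "Re z \<le> 1" using assms(1) complex_Re_le_cmod[of z] by simp
  then have "(1 - Re z) * 1 \<le> (1 - Re z) * (1 + Re z)"
    using assms(2) by (intro mult_left_mono) auto
  then have X: "0 \<le> 1 - Re z" "1 - Re z \<le> \<bar>Im z\<bar> * \<bar>Im z\<bar>"
    using e \<open>Re z \<le> 1\<close> by (simp_all add: power2_eq_square)
  have small: "\<bar>c * (1 - Re z)\<bar> < \<bar>Im z\<bar>" if "\<bar>c\<bar> * \<bar>Im z\<bar> < 1" "Im z \<noteq> 0" for c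
  proof -
    have "\<bar>c * (1 - Re z)\<bar> = \<bar>c\<bar> * (1 - Re z)"
      using X(1) by (simp add: abs_mult)
    also have "\<dots> \<le> \<bar>c\<bar> * (\<bar>Im z\<bar> * \<bar>Im z\<bar>)"
      using X by (intro mult_left_mono) auto
    also have "\<dots> = (\<bar>c\<bar> * \<bar>Im z\<bar>) * \<bar>Im z\<bar>" by simp
    also have "\<dots> < 1 * \<bar>Im z\<bar>"
      using that by (intro mult_strict_right_mono) auto
    finally show ?thesis by simp
  qed
  have "Im z = 0"
  proof (rule ccontr)
    assume nz: "Im z \<noteq> 0"
    show False
      using small[OF assms(3) nz] small[OF assms(4) nz] assms(5,6)
      unfolding weight_def by linarith
  qed
  then show ?thesis
    using e assms(2) by (simp add: complex_eq_iff)
qed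

section \<open>From null arcs to the support\<close>

theorem theorem1p1:
  fixes \<mu> :: "complex measure" and q :: "nat \<Rightarrow> real" and \<theta>1 \<theta>2 :: real
  assumes "prob_space \<mu>"
    and "sets \<mu> = sets (restrict_space borel unit_circle)"
    and "nontrivial_measure \<mu>"
    and "scaling_sequence (coeff_d \<mu>) q"
    and "\<theta>1 = 2 * arccot (SUP n\<in>{1..}. u_plus (coeff_c \<mu> n) (coeff_c \<mu> (n + 1)) (q (n + 1)))"
    and "\<theta>2 = 2 * arccot (INF n\<in>{1..}. u_minus (coeff_c \<mu> n) (coeff_c \<mu> (n + 1)) (q (n + 1)))"
    and "0 \<le> \<theta>1" and "\<theta>1 < \<theta>2" and "\<theta>2 \<le> 2 * pi"
  shows "msupport (diff_measure \<mu> (scale_measure (emeasure \<mu> {1}) (return \<mu> 1)))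
           \<subseteq> circle_arc \<theta>1 \<theta>2"
proof
  interpret circle_measure \<mu>
    using assms(1-3) by (simp add: circle_measure_def circle_measure_axioms_def)
  let ?c = "coeff_c \<mu>"
  define S where "S = (SUP n\<in>{1..}. u_plus (?c n) (?c (n + 1)) (q (n + 1)))"
  define I where "I = (INF n\<in>{1..}. u_minus (?c n) (?c (n + 1)) (q (n + 1)))"
  have \<theta>: "\<theta>1 = 2 * arccot S" "\<theta>2 = 2 * arccot I"
    using assms(5,6) by (simp_all add: S_def I_def)
  have q: "\<And>n. n \<ge> 1 \<Longrightarrow> 0 < q (n + 1)" "\<And>n. n \<ge> 1 \<Longrightarrow> q (n + 1) \<le> 1"
    and chain: "positive_chain_sequence (\<lambda>n. coeff_d \<mu> n / q n)"
    using assms(4) by (auto simp: scaling_sequence_def)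
  have S: "S = \<infinity> \<or> (\<exists>s. S = ereal s \<and> (AE z in \<mu>. 0 \<le> weight s z))"
  proof (cases S)
    case (real s)
    \<comment> \<open>The supremum itself serves as \<open>s\<close>, since
      \<open>u_plus_bound\<close> asks for a non-strict inequality only.\<close>
    have le: "u_plus (?c n) (?c (n + 1)) (q (n + 1)) \<le> ereal s" if "n \<ge> 1" for n
      unfolding real[symmetric] S_def using that by (intro SUP_upper) simp
    have "0 \<le> 1 * (LINT z|\<mu>. weight s z * (cmod (poly p z))\<^sup>2)" for p
      by (rule weighted_square_nonneg[OF _ chain q(1)])
         (use u_plus_bound[OF q le] in auto)
    from weight_AE_nonneg[OF this] real show ?thesis by auto
  next
    case MInf
    \<comment> \<open>\<open>u_plus\<close> never takes the value minus infinity, so neither does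
      the supremum.\<close>
    have "u_plus (?c 1) (?c (1 + 1)) (q (1 + 1)) \<le> S"
      unfolding S_def by (intro SUP_upper) simp
    with MInf show ?thesis by (auto simp: u_plus_def split: if_splits)
  qed simp
  have I: "I = -\<infinity> \<or> (\<exists>s. I = ereal s \<and> (AE z in \<mu>. weight s z \<le> 0))"
  proof (cases I)
    case (real s)
    have le: "ereal s \<le> u_minus (?c n) (?c (n + 1)) (q (n + 1))" if "n \<ge> 1" for n
      unfolding real[symmetric] I_def using that by (intro INF_lower) simp
    have "0 \<le> (- 1) * (LINT z|\<mu>. weight s z * (cmod (poly p z))\<^sup>2)" for p
      by (rule weighted_square_nonneg[OF _ chain q(1)])
         (use u_minus_bound[OF q le] in auto)
    from weight_AE_nonneg[OF this] real show ?thesis by auto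
  next
    case PInf
    have "I \<le> u_minus (?c 1) (?c (1 + 1)) (q (1 + 1))"
      unfolding I_def by (intro INF_lower) simp
    with PInf show ?thesis by (auto simp: u_minus_def split: if_splits)
  qed simp
  fix z
  assume z: "z \<in> msupport (diff_measure \<mu> (scale_measure (emeasure \<mu> {1}) (return \<mu> 1)))"
  \<comment> \<open>To exclude a position of \<open>z\<close> it now suffices to find an open
    neighbourhood in which almost every point equals 1.\<close>
  note outside = not_in_support_diff[where z = z, THEN notE, OF _ _ _ z]
  have "z \<in> space \<mu>" using z by (simp add: msupport_def)
  then have nz: "cmod z = 1" by (rule norm_space)
  then obtain \<theta> where \<theta>z: "0 \<le> \<theta>" "\<theta> < 2 * pi" "z = cis \<theta>"
    using sincos_total_2pi[of "Re z" "Im z"]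
    by (metis cmod_power2 cis.simps complex_surj one_power2)
  show "z \<in> circle_arc \<theta>1 \<theta>2"
  proof (cases "\<theta> = 0")
    case True
    then have z1: "z = 1" using \<theta>z by simp
    \<comment> \<open>The point 1 has the angles 0 and 2 pi: an infinite \<open>S\<close> or
      \<open>I\<close> puts it into the arc as an end point, and otherwise
      \<open>eq_one_near_one\<close> excludes it.\<close>
    consider "S = \<infinity>" | "I = -\<infinity>" | s i where "S = ereal s" "I = ereal i"
        "AE z in \<mu>. 0 \<le> weight s z" "AE z in \<mu>. weight i z \<le> 0"
      using S I by blast
    then show ?thesis
    proof cases
      case 1
      then have "\<theta>1 = 0" by (simp add: \<theta> arccot_def)
      then show ?thesis using assms(8) True \<theta>z unfolding circle_arc_def by force
    next
      case 2
      then have "\<theta>2 = 2 * pi" by (simp add: \<theta> arccot_def)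
      then have "z = cis \<theta>2" "\<theta>1 \<le> \<theta>2" using assms(8) z1 by simp_all
      then show ?thesis unfolding circle_arc_def by blast
    next
      case 3
      let ?U = "{w. Re w > 0 \<and> \<bar>s\<bar> * \<bar>Im w\<bar> < 1 \<and> \<bar>i\<bar> * \<bar>Im w\<bar> < 1}"
      have "open ?U"
        by (intro open_Collect_conj open_Collect_less continuous_intros)
      moreover have "z \<in> ?U" using z1 by simp
      moreover have "AE w in \<mu>. w \<in> ?U \<longrightarrow> w = 1"
        using 3(3,4) AE_space by eventually_elim (auto simp: norm_space intro: eq_one_near_one)
      ultimately show ?thesis by (rule outside)
    qed
  next
    case False
    then have t: "0 < \<theta> / 2" "\<theta> / 2 < pi" "z = cis (2 * (\<theta> / 2))" using \<theta>z by simp_all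
    consider "\<theta> < \<theta>1" | "\<theta>2 < \<theta>" | "\<theta>1 \<le> \<theta>" "\<theta> \<le> \<theta>2" by linarith
    then show ?thesis
    proof cases
      case 1
      then have "S \<noteq> \<infinity>" using \<theta>z(1) by (auto simp: \<theta> arccot_def)
      then obtain s where s: "S = ereal s" "AE z in \<mu>. 0 \<le> weight s z" using S by blast
      have "open {w. weight s w < 0}"
        by (intro open_Collect_less continuous_intros)
      moreover have "z \<in> {w. weight s w < 0}"
        using weight_cis_neg[of "\<theta> / 2" s] 1 t s by (simp add: \<theta>)
      moreover have "AE w in \<mu>. w \<in> {w. weight s w < 0} \<longrightarrow> w = 1"
        using s(2) by eventually_elim auto
      ultimately show ?thesis by (rule outside)
    next
      case 2
      then have "I \<noteq> -\<infinity>" using \<theta>z(2) by (auto simp: \<theta> arccot_def)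
      then obtain s where s: "I = ereal s" "AE z in \<mu>. weight s z \<le> 0" using I by blast
      have "open {w. 0 < weight s w}"
        by (intro open_Collect_less continuous_intros)
      moreover have "z \<in> {w. 0 < weight s w}"
        using weight_cis_pos[of s "\<theta> / 2"] 2 t s by (simp add: \<theta>)
      moreover have "AE w in \<mu>. w \<in> {w. 0 < weight s w} \<longrightarrow> w = 1"
        using s(2) by eventually_elim auto
      ultimately show ?thesis by (rule outside)
    next
      case 3
      then show ?thesis using \<theta>z unfolding circle_arc_def by blast
    qed
  qed
qed

end
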